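(* Let $\Gamma$ be an infinite, finitely generated group that has property (B). Then for each $\gamma\in\Gamma$, there exists $d_\gamma\in\mathbb{N}$ such that $\mathrm{Conj}_{\Gamma,\gamma}(n)\preceq n^{d_\gamma}$.
   Context: Property (B): for each $\gamma\in\Gamma$ there exist an integer $n_\gamma\ge1$ and $\rho_\gamma\in\mathrm{Hom}(\Gamma,\mathrm{SL}(n_\gamma,\mathbb{C}))$ such that $\mathrm{Tr}(\rho_\gamma(\gamma))\ne\mathrm{Tr}(\rho_\gamma(\eta))$ for every $\eta\in\Gamma$ not conjugate to $\gamma$. Let $X$ be a finite generating set of $\Gamma$ and $\|\gamma\|_X$ the word length. Write $[\gamma]$ for the $\Gamma$-conjugacy class of $\gamma$, $C_\Gamma$ for the set of conjugacy classes, $\|[\gamma]\|_X=\min\{\|\gamma'\|_X:\gamma'\in[\gamma]\}$, and $B_X(C_\Gamma,n)=\{[\gamma]:\|[\gamma]\|_X\le n\}$. For distinct classes $[\gamma]\neq[\eta]$ let $\mathrm{CD}_\Gamma([\gamma],[\eta])\in\mathbb{N}\cup\{\infty\}$ be the minimum of $|Q|$ over all finite groups $Q$ for which there is a homomorphism $\varphi\colon\Gamma\to Q$ with $\varphi(\gamma),\varphi(\eta)$ not conjugate in $Q$ ($\infty$ if there is none). For fixed $\gamma\in\Gamma$ define $$\mathrm{Conj}_{\Gamma,\gamma,X}(n)=\max\{\mathrm{CD}_\Gamma([\gamma],[\eta]) : [\eta]\in B_X(C_\Gamma,n),\ [\eta]\ne[\gamma]\}.$$ For functions $f,g$ on $\mathbb{N}=\{1,2,\dots\}$,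 $f\preceq g$ means there is a constant $C\in\mathbb{N}$ with $f(n)\le C\,g(Cn)$ for all $n\in\mathbb{N}$; $f\approx g$ means $f\preceq g$ and $g\preceq f$. Up to $\approx$, $\mathrm{Conj}_{\Gamma,\gamma,X}$ does not depend on $X$, so $X$ is dropped from the notation: $\mathrm{Conj}_{\Gamma,\gamma}$. *)

theory Defs
  imports
    "HOL-Algebra.Generated_Groups"
    "HOL-Library.Extended_Nat"
    "Jordan_Normal_Form.Determinant"
begin

definition SL :: "nat \<Rightarrow> complex mat monoid" where
  "SL n = \<lparr>carrier = {A \<in> carrier_mat n n. det A = 1}, monoid.mult = (*), one = 1\<^sub>m n\<rparr>"

definition trace_mat :: "'a::comm_monoid_add mat \<Rightarrow> 'a" where
  "trace_mat A = (\<Sum>i<dim_row A. A $$ (i, i))"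

definition conj_class :: "('a, 'b) monoid_scheme \<Rightarrow> 'a \<Rightarrow> 'a set" where
  "conj_class G g = {h \<otimes>\<^bsub>G\<^esub> g \<otimes>\<^bsub>G\<^esub> inv\<^bsub>G\<^esub> h | h. h \<in> carrier G}"

definition conj_classes :: "('a, 'b) monoid_scheme \<Rightarrow> 'a set set" where
  "conj_classes G = conj_class G ` carrier G"

definition is_conjugate :: "('a, 'b) monoid_scheme \<Rightarrow> 'a \<Rightarrow> 'a \<Rightarrow> bool" where
  "is_conjugate G g h \<longleftrightarrow> h \<in> conj_class G g"

definition property_B :: "('a, 'b) monoid_scheme \<Rightarrow> bool" where
  "property_B G \<longleftrightarrow>
     (\<forall>g \<in> carrier G. \<exists>n\<ge>1. \<exists>\<rho> \<in> hom G (SL n).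
        \<forall>h \<in> carrier G. \<not> is_conjugate G g h \<longrightarrow> trace_mat (\<rho> g) \<noteq> trace_mat (\<rho> h))"

definition finite_generating_set :: "('a, 'b) monoid_scheme \<Rightarrow> 'a set \<Rightarrow> bool" where
  "finite_generating_set G X \<longleftrightarrow> finite X \<and> X \<subseteq> carrier G \<and> generate G X = carrier G"

definition finitely_generated_group :: "('a, 'b) monoid_scheme \<Rightarrow> bool" where
  "finitely_generated_group G \<longleftrightarrow> group G \<and> (\<exists>X. finite_generating_set G X)"

definition word_length :: "('a, 'b) monoid_scheme \<Rightarrow> 'a set \<Rightarrow> 'a \<Rightarrow> nat" where
  "word_length G X g =
     (LEAST n. \<exists>w. length w = n \<and> set w \<subseteq> X \<union> (\<lambda>x. inv\<^bsub>G\<^esub> x) ` X \<and>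
                   foldr (\<otimes>\<^bsub>G\<^esub>) w \<one>\<^bsub>G\<^esub> = g)"

definition class_length :: "('a, 'b) monoid_scheme \<Rightarrow> 'a set \<Rightarrow> 'a set \<Rightarrow> nat" where
  "class_length G X c = (LEAST n. \<exists>g \<in> c. word_length G X g = n)"

definition class_ball :: "('a, 'b) monoid_scheme \<Rightarrow> 'a set \<Rightarrow> nat \<Rightarrow> 'a set set" where
  "class_ball G X n = {c \<in> conj_classes G. class_length G X c \<le> n}"

text \<open>The value depends only on the conjugacy classes of \<open>g\<close> and \<open>h\<close>. Every finite group is
  isomorphic to one whose carrier is a set of natural numbers, so it loses nothing to let \<open>Q\<close>
  range over structures on \<open>nat\<close>. The infimum is a minimum, except that it is \<open>\<infinity>\<close> if no finite
  quotient separates the two classes.\<close>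

definition CD :: "('a, 'b) monoid_scheme \<Rightarrow> 'a \<Rightarrow> 'a \<Rightarrow> enat" where
  "CD G g h =
     Inf {enat (card (carrier Q)) | (Q :: nat monoid) \<phi>.
            group Q \<and> finite (carrier Q) \<and> \<phi> \<in> hom G Q \<and> \<not> is_conjugate Q (\<phi> g) (\<phi> h)}"

text \<open>For an infinite group with finite generating set \<open>X\<close> and \<open>n \<ge> 1\<close> the set below is finite and
  nonempty (it involves the class of the identity or of a nontrivial generator), so \<open>Max\<close> is
  meaningful.\<close>

definition Conj :: "('a, 'b) monoid_scheme \<Rightarrow> 'a \<Rightarrow> 'a set \<Rightarrow> nat \<Rightarrow> enat" where
  "Conj G g X n =
     Max {CD G g h | h. h \<in> carrier G \<and> conj_class G h \<in> class_ball G X n \<and>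
                        conj_class G h \<noteq> conj_class G g}"

text \<open>Functions are considered on the positive integers only, and the constant is positive.\<close>

definition preceq :: "(nat \<Rightarrow> enat) \<Rightarrow> (nat \<Rightarrow> enat) \<Rightarrow> bool" (infix \<open>\<preceq>\<close> 50) where
  "f \<preceq> g \<longleftrightarrow> (\<exists>C\<ge>1. \<forall>n\<ge>1. f n \<le> enat C * g (C * n))"

end

theory Submission
  imports Defs "HOL-Number_Theory.Cong"
begin

text \<open>
  Fix \<open>\<gamma>\<close> and a representation \<open>\<rho>\<close> whose trace separates \<open>\<gamma>\<close> from all elements not conjugate to it.
  The entries of the matrices \<open>\<rho> \<eta>\<close> lie in a finitely generated subring \<open>R\<close> of the complex
  numbers. If \<open>\<eta>\<close> is a word of length \<open>m\<close> that is not conjugate to \<open>\<gamma>\<close>, then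
  \<open>x = tr (\<rho> \<gamma>) - tr (\<rho> \<eta>)\<close> is a nonzero value of an integer polynomial in the generators of \<open>R\<close> whose degree is linear in \<open>m\<close> and whose coefficients
  are exponential in \<open>m\<close>. It suffices to find an ideal \<open>I\<close> of \<open>R\<close> that avoids \<open>x\<close> and has index
  polynomial in \<open>m\<close>: the matrices modulo \<open>I\<close> form a finite quotient of the group, of order at
  most the index raised to the number of entries, and traces modulo \<open>I\<close> are constant on the
  conjugacy classes of this quotient (\<open>CD_le_index_power\<close>).

  The ideal comes from the structure of \<open>R\<close>. Let \<open>T\<close> be a transcendence basis among the generators
  and \<open>S = \<int>[T]\<close>. After inverting one nonzero \<open>f \<in> S\<close>, the ring \<open>R\<close> acts by multiplication on a free
  module with a finite basis \<open>e\<close>, and the matrix of an element of \<open>R\<close> is controlled by the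
  degree and the coefficients of the polynomial that represents it (\<open>multiplication_table\<close>). The
  matrix of \<open>x\<close> has a nonzero entry \<open>s\<close>. Substituting integers of size polynomial in \<open>m\<close> for \<open>T\<close> gives a ring
  homomorphism \<open>\<psi>\<close> from \<open>S\<close> to \<open>\<int>\<close> with \<open>\<psi> (f * s) \<noteq> 0\<close> (\<open>specialization\<close>). The integers \<open>\<psi> s\<close> and
  \<open>\<psi> f\<close> have absolute value at most \<open>2 ^ a\<close> with \<open>a\<close> polynomial in \<open>m\<close>. Since a positive common multiple of
  \<open>1, \<dots>, 2 * n\<close> is at least \<open>2 ^ n\<close>, some prime power \<open>q\<close> of size \<open>O(a\<^sup>2)\<close> is coprime to \<open>\<psi> f\<close> and
  does not divide \<open>\<psi> s\<close> (\<open>small_coprime_non_divisor\<close>). The elements of \<open>R\<close> whose matrix vanishes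
  modulo \<open>q\<close> after applying \<open>\<psi>\<close> form the required ideal; its index is at most
  \<open>q ^ (card e)\<^sup>2\<close>.

  The exponent depends on the module chosen for \<open>R\<close> and on the size of the matrices only, so it
  serves all generating sets at once; another generating set changes the constants.
\<close>

section \<open>Values of integer polynomials\<close>

text \<open>\<open>int_poly_value A D H x\<close> says that \<open>x\<close> is the value at elements of \<open>A\<close> of an integer
polynomial of total degree at most \<open>D\<close> whose coefficients have absolute values summing to at most
\<open>H\<close>. The sum of absolute values is the right norm here because it is submultiplicative.\<close>

inductive int_poly_value :: "complex set \<Rightarrow> nat \<Rightarrow> nat \<Rightarrow> complex \<Rightarrow> bool" for A where
  zero: "int_poly_value A 0 0 0"
| one: "int_poly_value A 0 1 1"
| gen: "a \<in> A \<Longrightarrow> int_poly_value A D H x \<Longrightarrow> int_poly_value A (Suc D) H (a * x)"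
| add: "int_poly_value A D H x \<Longrightarrow> int_poly_value A D H' y \<Longrightarrow> int_poly_value A D (H + H') (x + y)"
| minus: "int_poly_value A D H x \<Longrightarrow> int_poly_value A D H (- x)"
| mono: "int_poly_value A D H x \<Longrightarrow> D \<le> D' \<Longrightarrow> H \<le> H' \<Longrightarrow> int_poly_value A D' H' x"

lemma int_poly_value_mult:
  assumes "int_poly_value A D H x" "int_poly_value A D' H' y"
  shows "int_poly_value A (D + D') (H * H') (x * y)"
  using assms(1)
proof induction
  case zero
  show ?case using int_poly_value.mono[OF int_poly_value.zero[of A], of D' 0] by simp
next
  case one
  show ?case using assms(2) by simp
next
  case (gen a D H x)
  from int_poly_value.gen[OF gen(1) gen.IH] show ?case by (simp add: mult.assoc)
next
  case (add D H x H2 z)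
  from int_poly_value.add[OF add.IH] show ?case by (simp add: algebra_simps)
next
  case (minus D H x)
  from int_poly_value.minus[OF minus.IH] show ?case by simp
next
  case (mono D H x D2 H2)
  show ?case by (rule int_poly_value.mono[OF mono.IH]) (use mono in \<open>auto intro: mult_right_mono\<close>)
qed

lemma int_poly_value_power:
  "int_poly_value A D H x \<Longrightarrow> int_poly_value A (n * D) (H ^ n) (x ^ n)"
  by (induction n) (auto intro: int_poly_value.one[simplified] int_poly_value_mult)

lemma int_poly_value_sum:
  assumes "finite I" "\<And>i. i \<in> I \<Longrightarrow> int_poly_value A D (H i) (x i)"
  shows "int_poly_value A D (sum H I) (sum x I)"
  using assms
proof (induction I rule: finite_induct)
  case empty
  show ?case using int_poly_value.mono[OF int_poly_value.zero[of A], of D 0] by simp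
next
  case (insert i I)
  then show ?case by (auto intro: int_poly_value.add)
qed

lemma int_poly_value_of_int: "int_poly_value A 0 (nat \<bar>z\<bar>) (of_int z)"
proof -
  have *: "int_poly_value A 0 n (of_nat n)" for n
  proof (induction n)
    case (Suc n)
    from int_poly_value.add[OF Suc int_poly_value.one] show ?case by (simp add: add.commute)
  qed (use int_poly_value.zero in simp)
  show ?thesis
    using *[of "nat z"] int_poly_value.minus[OF *[of "nat (- z)"]] by (cases "z \<ge> 0") auto
qed

lemma int_poly_value_uniform:
  assumes "finite I" "\<And>i. i \<in> I \<Longrightarrow> \<exists>D H. int_poly_value A D H (x i)"
  shows "\<exists>D H. \<forall>i\<in>I. int_poly_value A D H (x i)"
proof -
  obtain D H where DH: "\<And>i. i \<in> I \<Longrightarrow> int_poly_value A (D i) (H i) (x i)"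
    using assms(2) by metis
  show ?thesis
    by (rule exI[of _ "sum D I"], rule exI[of _ "sum H I"])
      (use DH assms(1) in \<open>auto intro!: int_poly_value.mono[OF DH] member_le_sum\<close>)
qed

definition subring_generated :: "complex set \<Rightarrow> complex set" where
  "subring_generated A = {x. \<exists>D H. int_poly_value A D H x}"

lemma subring_generatedI: "int_poly_value A D H x \<Longrightarrow> x \<in> subring_generated A"
  by (auto simp: subring_generated_def)

lemma subring_generated_of_int [simp]: "of_int z \<in> subring_generated A"
  by (rule subring_generatedI[OF int_poly_value_of_int])

lemma subring_generated_0 [simp]: "0 \<in> subring_generated A"
  and subring_generated_1 [simp]: "1 \<in> subring_generated A"
  by (rule subring_generatedI, rule int_poly_value.zero int_poly_value.one)+

lemma subring_generated_mult [intro]: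
  "x \<in> subring_generated A \<Longrightarrow> y \<in> subring_generated A \<Longrightarrow> x * y \<in> subring_generated A"
  by (auto simp: subring_generated_def dest: int_poly_value_mult)

lemma subring_generated_add [intro]:
  assumes "x \<in> subring_generated A" "y \<in> subring_generated A"
  shows "x + y \<in> subring_generated A"
proof -
  from assms obtain D H D' H' where "int_poly_value A D H x" "int_poly_value A D' H' y"
    by (auto simp: subring_generated_def)
  then have "int_poly_value A (max D D') H x" "int_poly_value A (max D D') H' y"
    by (auto intro: int_poly_value.mono)
  from int_poly_value.add[OF this] show ?thesis by (rule subring_generatedI)
qed

lemma subring_generated_minus [intro]:
  "x \<in> subring_generated A \<Longrightarrow> - x \<in> subring_generated A"
  by (auto simp: subring_generated_def dest: int_poly_value.minus)

lemma subring_generated_diff [intro]: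
  "x \<in> subring_generated A \<Longrightarrow> y \<in> subring_generated A \<Longrightarrow> x - y \<in> subring_generated A"
  using subring_generated_add[of x A "- y"] by auto

lemma subring_generated_power [intro]:
  "x \<in> subring_generated A \<Longrightarrow> x ^ n \<in> subring_generated A"
  by (induction n) auto

lemma subring_generated_sum [intro]:
  "(\<And>i. i \<in> I \<Longrightarrow> x i \<in> subring_generated A) \<Longrightarrow> sum x I \<in> subring_generated A"
  by (induction I rule: infinite_finite_induct) auto

lemma subring_generated_base [intro]: "a \<in> A \<Longrightarrow> a \<in> subring_generated A"
  using int_poly_value.gen[OF _ int_poly_value.one, of a A] by (auto intro: subring_generatedI)

text \<open>Ring homomorphisms from a subring \<open>S\<close> of the complex numbers to the integers are encoded as
functions on all complex numbers that are constrained on \<open>S\<close> only.\<close>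

definition int_hom :: "complex set \<Rightarrow> (complex \<Rightarrow> int) \<Rightarrow> bool" where
  "int_hom S \<psi> \<longleftrightarrow> \<psi> 1 = 1 \<and> (\<forall>x\<in>S. \<forall>y\<in>S. \<psi> (x + y) = \<psi> x + \<psi> y \<and> \<psi> (x * y) = \<psi> x * \<psi> y)"

context
  fixes T :: "complex set" and \<psi> :: "complex \<Rightarrow> int"
  assumes hom: "int_hom (subring_generated T) \<psi>"
begin

lemma int_hom_1: "\<psi> 1 = 1"
  and int_hom_add: "x \<in> subring_generated T \<Longrightarrow> y \<in> subring_generated T \<Longrightarrow> \<psi> (x + y) = \<psi> x + \<psi> y"
  and int_hom_mult: "x \<in> subring_generated T \<Longrightarrow> y \<in> subring_generated T \<Longrightarrow> \<psi> (x * y) = \<psi> x * \<psi> y"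
  using hom by (auto simp: int_hom_def)

lemma int_hom_0: "\<psi> 0 = 0"
  using int_hom_add[of 0 0] by simp

lemma int_hom_minus: "x \<in> subring_generated T \<Longrightarrow> \<psi> (- x) = - \<psi> x"
  using int_hom_add[of x "- x"] int_hom_0 by (auto simp: subring_generated_minus)

lemma int_hom_diff:
  "x \<in> subring_generated T \<Longrightarrow> y \<in> subring_generated T \<Longrightarrow> \<psi> (x - y) = \<psi> x - \<psi> y"
  using int_hom_add[of x "- y"] int_hom_minus[of y] by (auto simp: subring_generated_minus)

lemma int_hom_power: "x \<in> subring_generated T \<Longrightarrow> \<psi> (x ^ n) = \<psi> x ^ n"
  by (induction n) (auto simp: int_hom_1 int_hom_mult subring_generated_power)

lemma int_hom_sum:
  "(\<And>i. i \<in> I \<Longrightarrow> x i \<in> subring_generated T) \<Longrightarrow> \<psi> (sum x I) = (\<Sum>i\<in>I. \<psi> (x i))"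
  by (induction I rule: infinite_finite_induct) (auto simp: int_hom_0 int_hom_add subring_generated_sum)

lemma int_hom_of_int: "\<psi> (of_int z) = z"
proof -
  have *: "\<psi> (of_nat n) = int n" for n
    using int_hom_add[OF subring_generated_1 subring_generated_of_int[of "int _"]]
    by (induction n) (auto simp: int_hom_0 int_hom_1)
  show ?thesis
    using *[of "nat z"] *[of "nat (- z)"] int_hom_minus[of "of_nat (nat (- z))"]
      subring_generated_of_int[of "int (nat (- z))" T]
    by (cases "z \<ge> 0") auto
qed

text \<open>The evaluation estimate: a homomorphism with values at most \<open>M\<close> on \<open>T\<close> maps each monomial of
degree at most \<open>D\<close> to an integer of absolute value at most \<open>M ^ D\<close>.\<close>

lemma int_hom_bound:
  assumes "int_poly_value T D H x" "\<And>t. t \<in> T \<Longrightarrow> \<bar>\<psi> t\<bar> \<le> M" "M \<ge> 1"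
  shows "\<bar>\<psi> x\<bar> \<le> int H * M ^ D"
  using assms(1)
proof induction
  case (gen a D H x)
  have "\<bar>\<psi> (a * x)\<bar> = \<bar>\<psi> a\<bar> * \<bar>\<psi> x\<bar>"
    using gen by (simp add: int_hom_mult subring_generated_base subring_generatedI abs_mult)
  also have "\<dots> \<le> M * (int H * M ^ D)"
    using gen assms by (intro mult_mono) auto
  finally show ?case by (simp add: algebra_simps)
next
  case (add D H x H' y)
  then have "\<psi> (x + y) = \<psi> x + \<psi> y"
    by (intro int_hom_add subring_generatedI)
  then show ?case using add.IH by (simp add: algebra_simps)
next
  case (minus D H x)
  then show ?case by (simp add: int_hom_minus subring_generatedI)
next
  case (mono D H x D' H')
  have "int H * M ^ D \<le> int H' * M ^ D'"
    using mono assms(3) by (intro mult_mono power_increasing) auto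
  then show ?case using mono.IH by linarith
qed (auto simp: int_hom_0 int_hom_1)

end

section \<open>Specialization of algebraically independent numbers\<close>

definition algebraic_over :: "complex set \<Rightarrow> complex \<Rightarrow> bool" where
  "algebraic_over S x \<longleftrightarrow> (\<exists>p. p \<noteq> 0 \<and> (\<forall>i. coeff p i \<in> S) \<and> poly p x = 0)"

text \<open>For a ring \<open>S\<close>, being algebraic over \<open>S\<close> and over its field of fractions are the same, so this
describes the finite algebraically independent sets, built up one transcendental element at a
time.\<close>

inductive alg_independent :: "complex set \<Rightarrow> bool" where
  empty: "alg_independent {}"
| insert: "alg_independent T \<Longrightarrow> \<not> algebraic_over (subring_generated T) t \<Longrightarrow> alg_independent (insert t T)"

text \<open>Collecting powers of the last variable: the coefficients inherit the bound on the degree, which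
is what allows an induction over the variables.\<close>

lemma int_poly_value_as_poly:
  assumes "int_poly_value (insert t T) D H x"
  shows "\<exists>p. poly p t = x \<and> degree p \<le> D \<and> (\<forall>i. \<exists>H. int_poly_value T D H (coeff p i))"
  using assms
proof induction
  case zero
  show ?case by (rule exI[of _ 0]) (auto intro: int_poly_value.zero)
next
  case one
  have "\<exists>H. int_poly_value T 0 H (coeff 1 i)" for i
    using int_poly_value.zero int_poly_value.one by (cases "i = 0") auto
  then show ?case by (intro exI[of _ 1]) auto
next
  case (gen a D H x)
  then obtain p where p: "poly p t = x" "degree p \<le> D" "\<And>i. \<exists>H. int_poly_value T D H (coeff p i)"
    by blast
  show ?case
  proof (cases "a = t")
    case True
    have "int_poly_value T (Suc D) 0 0"
      using int_poly_value.mono[OF int_poly_value.zero] by simp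
    then have "\<exists>H. int_poly_value T (Suc D) H (coeff (pCons 0 p) i)" for i
      using p(3)[of "i - 1"] int_poly_value.mono[of T D _ _ "Suc D"]
      by (cases i) (auto simp: coeff_pCons)
    moreover have "degree (pCons 0 p) \<le> Suc D"
      using p(2) degree_pCons_le[of 0 p] by linarith
    ultimately show ?thesis
      using p(1) True by (intro exI[of _ "pCons 0 p"]) auto
  next
    case False
    then have "a \<in> T" using gen by auto
    then have "\<exists>H. int_poly_value T (Suc D) H (coeff (smult a p) i)" for i
      using p(3)[of i] by (auto intro: int_poly_value.gen)
    then show ?thesis
      using p(1,2) by (intro exI[of _ "smult a p"]) auto
  qed
next
  case (add D H x H' y)
  then obtain p r where "poly p t = x" "degree p \<le> D" "\<forall>i. \<exists>H. int_poly_value T D H (coeff p i)"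
    "poly r t = y" "degree r \<le> D" "\<forall>i. \<exists>H. int_poly_value T D H (coeff r i)"
    by blast
  then show ?case
    by (intro exI[of _ "p + r"]) (auto intro: degree_add_le, meson int_poly_value.add)
next
  case (minus D H x)
  then obtain p where "poly p t = x" "degree p \<le> D" "\<forall>i. \<exists>H. int_poly_value T D H (coeff p i)"
    by blast
  then show ?case
    by (intro exI[of _ "- p"]) (auto, meson int_poly_value.minus)
next
  case (mono D H x D' H')
  then obtain p where p: "poly p t = x" "degree p \<le> D" "\<forall>i. \<exists>H. int_poly_value T D H (coeff p i)"
    by blast
  have "\<exists>H. int_poly_value T D' H (coeff p i)" for i
    using p(3) int_poly_value.mono[OF _ mono.hyps(2) le_refl] by blast
  then show ?case using p mono.hyps by (intro exI[of _ p]) auto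
qed

lemma subring_generated_poly:
  assumes "\<And>i. coeff p i \<in> subring_generated T" "x \<in> subring_generated T"
  shows "poly p x \<in> subring_generated T"
  using assms by (auto simp: poly_altdef)

lemma poly_mult_coeff_closed:
  assumes "\<And>i. coeff p i \<in> subring_generated T" "\<And>i. coeff r i \<in> subring_generated T"
  shows "coeff (p * r) i \<in> subring_generated T"
  using assms by (auto simp: coeff_mult)

text \<open>The variables in \<open>T\<close> are replaced by integers one at a time. A nonzero polynomial of degree at
most \<open>D\<close> has a nonroot among \<open>0, \<dots>, D\<close>, and substituting an integer for one variable does not
raise the degree in the others, so the same range works for each variable.\<close>

lemma specialization:
  assumes "alg_independent T" "int_poly_value T D H x" "x \<noteq> 0"
  shows "\<exists>\<psi>. int_hom (subring_generated T) \<psi> \<and> \<psi> x \<noteq> 0 \<and> (\<forall>t\<in>T. \<bar>\<psi> t\<bar> \<le> int D)"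
  using assms
proof (induction arbitrary: H x)
  case empty
  have *: "y \<in> \<int>" if "int_poly_value {} D H y" for D H y
    using that by induction auto
  have "int_hom (subring_generated {}) (\<lambda>y. \<lfloor>Re y\<rfloor>)"
    unfolding int_hom_def
  proof (intro conjI ballI)
    fix y z :: complex assume "y \<in> subring_generated {}" "z \<in> subring_generated {}"
    then have "y \<in> \<int>" "z \<in> \<int>" using * by (auto simp: subring_generated_def)
    then obtain a b where "y = of_int a" "z = of_int b" by (elim Ints_cases)
    then show "\<lfloor>Re (y + z)\<rfloor> = \<lfloor>Re y\<rfloor> + \<lfloor>Re z\<rfloor>" "\<lfloor>Re (y * z)\<rfloor> = \<lfloor>Re y\<rfloor> * \<lfloor>Re z\<rfloor>"
      by (simp_all only: of_int_add[symmetric] of_int_mult[symmetric] complex_Re_of_int floor_of_int)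
  qed simp
  moreover have "\<lfloor>Re x\<rfloor> \<noteq> 0"
    using *[OF empty(1)] empty(2) by (auto elim!: Ints_cases)
  ultimately show ?case by auto
next
  case (insert T t)
  obtain p where p: "poly p t = x" "degree p \<le> D" "\<And>i. \<exists>H. int_poly_value T D H (coeff p i)"
    using int_poly_value_as_poly[OF insert.prems(1)] by blast
  have "p \<noteq> 0" using p(1) insert.prems by auto
  \<comment> \<open>a nonzero polynomial of degree at most \<open>D\<close> does not vanish at all of the
    \<open>D + 1\<close> integers \<open>0, \<dots>, D\<close>\<close>
  have "\<exists>c\<in>{0..int D}. poly p (of_int c) \<noteq> 0"
  proof (rule ccontr)
    assume "\<not> ?thesis"
    then have "of_int ` {0..int D} \<subseteq> {z. poly p z = 0}" by auto
    moreover have "card (of_int ` {0..int D} :: complex set) = D + 1"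
      by (subst card_image) (auto simp: inj_on_def)
    ultimately have "D + 1 \<le> card {z. poly p z = 0}"
      by (metis card_mono poly_roots_finite \<open>p \<noteq> 0\<close>)
    also have "\<dots> \<le> degree p" using \<open>p \<noteq> 0\<close> by (rule card_poly_roots_bound)
    finally show False using p(2) by simp
  qed
  then obtain c where c: "0 \<le> c" "c \<le> int D" "poly p (of_int c) \<noteq> 0" by auto
  obtain Hc where Hc: "\<And>i. int_poly_value T D (Hc i) (coeff p i)" using p(3) by metis
  have "int_poly_value T D (\<Sum>i\<le>degree p. Hc i * nat \<bar>c ^ i\<bar>) (poly p (of_int c))"
    unfolding poly_altdef
  proof (rule int_poly_value_sum)
    fix i
    show "int_poly_value T D (Hc i * nat \<bar>c ^ i\<bar>) (coeff p i * of_int c ^ i)"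
      using int_poly_value_mult[OF Hc[of i] int_poly_value_of_int[of T "c ^ i"]] by simp
  qed auto
  from insert.IH[OF this c(3)] obtain \<psi>\<^sub>0 where \<psi>\<^sub>0: "int_hom (subring_generated T) \<psi>\<^sub>0"
    "\<psi>\<^sub>0 (poly p (of_int c)) \<noteq> 0" "\<And>t. t \<in> T \<Longrightarrow> \<bar>\<psi>\<^sub>0 t\<bar> \<le> int D" by blast
  define good where "good r \<longleftrightarrow> (\<forall>i. coeff r i \<in> subring_generated T)" for r
  define \<psi> where "\<psi> y = \<psi>\<^sub>0 (poly (SOME r. good r \<and> poly r t = y) (of_int c))" for y
  \<comment> \<open>as \<open>t\<close> is transcendental over the ring of coefficients, the polynomial \<open>r\<close> is determined
    by its value at \<open>t\<close>\<close>
  have \<psi>: "\<psi> (poly r t) = \<psi>\<^sub>0 (poly r (of_int c))" if "good r" for r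
  proof -
    define r' where "r' = (SOME r'. good r' \<and> poly r' t = poly r t)"
    have r': "good r' \<and> poly r' t = poly r t"
      unfolding r'_def by (rule someI[of _ r]) (use that in auto)
    then have "\<forall>i. coeff (r' - r) i \<in> subring_generated T" "poly (r' - r) t = 0"
      using that by (auto simp: good_def)
    then have "r' - r = 0"
      using insert.hyps(2) unfolding algebraic_over_def by blast
    then show ?thesis by (simp add: \<psi>_def r'_def[symmetric])
  qed
  have ex: "\<exists>r. good r \<and> poly r t = y" if "y \<in> subring_generated (insert t T)" for y
  proof -
    from that obtain D H where "int_poly_value (insert t T) D H y"
      by (auto simp: subring_generated_def)
    from int_poly_value_as_poly[OF this] show ?thesis
      unfolding subring_generated_def good_def by blast
  qed
  have val: "poly r (of_int c) \<in> subring_generated T" if "good r" for r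
    using that by (intro subring_generated_poly) (auto simp: good_def)
  have "int_hom (subring_generated (insert t T)) \<psi>"
    unfolding int_hom_def
  proof (intro conjI ballI)
    have "good 1" by (auto simp: good_def of_bool_def)
    from \<psi>[OF this] show "\<psi> 1 = 1" using \<psi>\<^sub>0(1) by (simp add: int_hom_def)
  next
    fix y z assume "y \<in> subring_generated (insert t T)" "z \<in> subring_generated (insert t T)"
    then obtain r s where rs: "good r" "poly r t = y" "good s" "poly s t = z" using ex by meson
    have "good (r + s)" "good (r * s)"
      using rs by (auto simp: good_def poly_mult_coeff_closed)
    from this[THEN \<psi>] rs val[of r] val[of s]
    show "\<psi> (y + z) = \<psi> y + \<psi> z" "\<psi> (y * z) = \<psi> y * \<psi> z"
      using \<psi>[of r] \<psi>[of s] \<psi>\<^sub>0(1) by (simp_all add: int_hom_def)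
  qed
  moreover have "good p" unfolding good_def subring_generated_def using p(3) by blast
  then have "\<psi> x \<noteq> 0" using \<psi>[of p] p(1) \<psi>\<^sub>0(2) by simp
  moreover have "\<bar>\<psi> u\<bar> \<le> int D" if "u \<in> insert t T" for u
  proof (cases "u = t")
    case True
    have "good [:0, 1:]" by (auto simp: good_def coeff_pCons split: nat.splits)
    from \<psi>[OF this] True show ?thesis using int_hom_of_int[OF \<psi>\<^sub>0(1), of c] c by simp
  next
    case False
    then have "u \<in> T" using that by simp
    then have "good [:u:]" by (auto simp: good_def coeff_pCons split: nat.splits)
    from \<psi>[OF this] \<psi>\<^sub>0(3)[OF \<open>u \<in> T\<close>] show ?thesis by simp
  qed
  ultimately show ?case by blast
qed

section \<open>Finitely generated rings acting on free modules\<close>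

lemma int_poly_value_subset:
  assumes "int_poly_value A D H x" "A \<subseteq> B"
  shows "int_poly_value B D H x"
  using assms(1)
proof induction
  case (gen a D H x)
  show ?case by (rule int_poly_value.gen[OF _ gen.IH]) (use gen.hyps assms(2) in auto)
next
  case (mono D H x D' H')
  show ?case by (rule int_poly_value.mono[OF mono.IH mono.hyps(2,3)])
next
  case (add D H x H' y)
  from add.IH show ?case by (rule int_poly_value.add)
next
  case (minus D H x)
  from minus.IH show ?case by (rule int_poly_value.minus)
qed (rule int_poly_value.zero int_poly_value.one)+

lemma subring_generated_mono: "A \<subseteq> B \<Longrightarrow> subring_generated A \<subseteq> subring_generated B"
  by (auto simp: subring_generated_def dest: int_poly_value_subset)

lemma algebraic_over_self:
  assumes "x \<in> subring_generated T"
  shows "algebraic_over (subring_generated T) x"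
  unfolding algebraic_over_def
  by (rule exI[of _ "[:- x, 1:]"])
    (use assms in \<open>auto simp: coeff_pCons subring_generated_minus split: nat.splits\<close>)

text \<open>Elements are added to \<open>T\<close> as long as they are transcendental over the ring generated so far.\<close>

lemma transcendence_basis:
  assumes "finite A"
  shows "\<exists>T. alg_independent T \<and> (\<forall>a\<in>A. algebraic_over (subring_generated T) a)"
  using assms
proof (induction A rule: finite_induct)
  case empty
  then show ?case using alg_independent.empty by auto
next
  case (insert a A)
  then obtain T where T: "alg_independent T" "\<And>b. b \<in> A \<Longrightarrow> algebraic_over (subring_generated T) b"
    by blast
  show ?case
  proof (cases "algebraic_over (subring_generated T) a")
    case False
    have "algebraic_over (subring_generated (insert a T)) b" if "b \<in> insert a A" for b
    proof (cases "b = a")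
      case True
      then show ?thesis by (intro algebraic_over_self) auto
    next
      case False
      then show ?thesis
        using that T(2)[of b] subring_generated_mono[of T "insert a T"]
        unfolding algebraic_over_def by blast
    qed
    then show ?thesis using alg_independent.insert[OF T(1) False] by blast
  qed (use T in blast)
qed

definition lin_span :: "complex set \<Rightarrow> complex set \<Rightarrow> complex set" where
  "lin_span S B = {\<Sum>b\<in>B. s b * b | s. \<forall>b\<in>B. s b \<in> S}"

definition lin_independent :: "complex set \<Rightarrow> complex set \<Rightarrow> bool" where
  "lin_independent S B \<longleftrightarrow> (\<forall>s. (\<forall>b\<in>B. s b \<in> S) \<longrightarrow> (\<Sum>b\<in>B. s b * b) = 0 \<longrightarrow> (\<forall>b\<in>B. s b = 0))"

lemma lin_spanE:
  assumes "x \<in> lin_span S B"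
  obtains s where "\<And>b. b \<in> B \<Longrightarrow> s b \<in> S" "x = (\<Sum>b\<in>B. s b * b)"
  using assms by (auto simp: lin_span_def)

lemma lin_spanI: "(\<And>b. b \<in> B \<Longrightarrow> s b \<in> S) \<Longrightarrow> x = (\<Sum>b\<in>B. s b * b) \<Longrightarrow> x \<in> lin_span S B"
  by (auto simp: lin_span_def)

context
  fixes T :: "complex set" and S :: "complex set"
  defines "S \<equiv> subring_generated T"
begin

lemma lin_span_0: "0 \<in> lin_span S B"
  by (rule lin_spanI[of _ "\<lambda>_. 0"]) (auto simp: S_def)

lemma lin_span_base: "finite B \<Longrightarrow> b \<in> B \<Longrightarrow> b \<in> lin_span S B"
  by (rule lin_spanI[of _ "\<lambda>b'. if b' = b then 1 else 0"])
    (auto simp: S_def if_distrib[of "\<lambda>x. x * _"] cong: if_cong)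

lemma lin_span_add: "x \<in> lin_span S B \<Longrightarrow> y \<in> lin_span S B \<Longrightarrow> x + y \<in> lin_span S B"
proof (elim lin_spanE)
  fix s r assume "\<And>b. b \<in> B \<Longrightarrow> s b \<in> S" "x = (\<Sum>b\<in>B. s b * b)"
    "\<And>b. b \<in> B \<Longrightarrow> r b \<in> S" "y = (\<Sum>b\<in>B. r b * b)"
  then show "x + y \<in> lin_span S B"
    by (intro lin_spanI[of _ "\<lambda>b. s b + r b"]) (auto simp: S_def sum.distrib algebra_simps)
qed

lemma lin_span_scale: "c \<in> S \<Longrightarrow> x \<in> lin_span S B \<Longrightarrow> c * x \<in> lin_span S B"
proof (elim lin_spanE)
  fix s assume "c \<in> S" "\<And>b. b \<in> B \<Longrightarrow> s b \<in> S" "x = (\<Sum>b\<in>B. s b * b)"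
  then show "c * x \<in> lin_span S B"
    by (intro lin_spanI[of _ "\<lambda>b. c * s b"]) (auto simp: S_def sum_distrib_left algebra_simps)
qed

lemma lin_span_sum: "(\<And>i. i \<in> I \<Longrightarrow> x i \<in> lin_span S B) \<Longrightarrow> sum x I \<in> lin_span S B"
  by (induction I rule: infinite_finite_induct) (auto simp: lin_span_0 lin_span_add)

lemma lin_span_transfer:
  assumes "x \<in> lin_span S B" "\<And>b. b \<in> B \<Longrightarrow> c * b \<in> lin_span S B'"
  shows "c * x \<in> lin_span S B'"
proof -
  obtain s where s: "\<And>b. b \<in> B \<Longrightarrow> s b \<in> S" "x = (\<Sum>b\<in>B. s b * b)"
    using assms(1) by (blast elim: lin_spanE)
  have "(\<Sum>b\<in>B. s b * (c * b)) \<in> lin_span S B'"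
    by (intro lin_span_sum lin_span_scale s assms)
  then show ?thesis by (simp add: s(2) sum_distrib_left algebra_simps)
qed

text \<open>\<open>B\<close> consists of monomials in the elements of \<open>A\<close>. When \<open>a\<close> is adjoined with a polynomial
equation of degree \<open>d\<close>, the new spanning set is \<open>b * a ^ i\<close> for \<open>b \<in> B\<close> and \<open>i < d\<close>; the leading
coefficient of the equation is absorbed into \<open>f\<close>, so that \<open>f * a ^ d\<close> reduces to lower powers.\<close>

lemma common_spanning_set:
  assumes "finite A" "\<And>a. a \<in> A \<Longrightarrow> algebraic_over S a"
  shows "\<exists>B f. finite B \<and> 1 \<in> B \<and> f \<in> S \<and> f \<noteq> 0 \<and> (\<forall>a\<in>A. \<forall>b\<in>B. f * a * b \<in> lin_span S B)"
  using assms
proof (induction A rule: finite_induct)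
  case empty
  show ?case by (rule exI[of _ "{1}"], rule exI[of _ 1]) (auto simp: S_def)
next
  case (insert a A)
  then obtain B f where B: "finite B" "1 \<in> B" "f \<in> S" "f \<noteq> 0"
    "\<And>a b. a \<in> A \<Longrightarrow> b \<in> B \<Longrightarrow> f * a * b \<in> lin_span S B" by blast
  obtain p where p: "p \<noteq> 0" "\<And>i. coeff p i \<in> S" "poly p a = 0"
    using insert.prems[of a] by (auto simp: algebraic_over_def)
  define d where "d = degree p"
  define g where "g = lead_coeff p"
  have "d > 0"
  proof (rule ccontr)
    assume "\<not> d > 0"
    then obtain c where "p = [:c:]" by (auto simp: d_def elim: degree_eq_zeroE)
    then show False using p by auto
  qed
  define B' where "B' = (\<lambda>(b, i). b * a ^ i) ` (B \<times> {..<d})"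
  have B'_base: "b * a ^ i \<in> lin_span S B'" if "b \<in> B" "i < d" for b i
    using that B(1) by (intro lin_span_base) (auto simp: B'_def)
  have "g * a ^ d = - (\<Sum>i<d. coeff p i * a ^ i)"
  proof -
    have "(\<Sum>i\<le>d. coeff p i * a ^ i) = 0" using p(3) by (simp add: poly_altdef d_def)
    moreover have "{..d} = insert d {..<d}" by auto
    ultimately show ?thesis by (simp add: g_def d_def add_eq_0_iff)
  qed
  then have top: "g * (b * a ^ d) \<in> lin_span S B'" if "b \<in> B" for b
  proof -
    have "g * (b * a ^ d) = b * (g * a ^ d)" by simp
    also have "\<dots> = (\<Sum>i<d. - coeff p i * (b * a ^ i))"
      unfolding \<open>g * a ^ d = _\<close> by (simp add: sum_distrib_left sum_negf algebra_simps)
    also have "\<dots> \<in> lin_span S B'"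
      by (intro lin_span_sum lin_span_scale B'_base that)
        (use p(2) in \<open>auto simp: S_def subring_generated_minus\<close>)
    finally show ?thesis .
  qed
  have g: "g \<in> S" "g \<noteq> 0" using p by (auto simp: g_def)
  have "f * g * a' * c \<in> lin_span S B'" if "a' \<in> insert a A" and c': "c \<in> B'" for a' c
  proof -
    obtain b i where c: "c = b * a ^ i" "b \<in> B" "i < d" using c' by (auto simp: B'_def)
    show ?thesis
    proof (cases "a' = a")
      case True
      have "g * (b * a ^ Suc i) \<in> lin_span S B'"
        using top[OF c(2)] lin_span_scale[OF g(1) B'_base[OF c(2), of "Suc i"]] c(3)
        by (cases "Suc i = d") auto
      from lin_span_scale[OF B(3) this] show ?thesis
        by (simp add: True c(1) algebra_simps)
    next
      case False
      then have "f * a' * b \<in> lin_span S B" using that c by (intro B) auto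
      then have "a ^ i * (f * a' * b) \<in> lin_span S B'"
        by (rule lin_span_transfer) (use B'_base c(3) in \<open>simp add: mult.commute\<close>)
      from lin_span_scale[OF g(1) this] show ?thesis by (simp add: c(1) algebra_simps)
    qed
  qed
  moreover have "1 * a ^ 0 \<in> B'"
    using imageI[of "(1, 0)" "B \<times> {..<d}" "\<lambda>(b, i). b * a ^ i"] B(2) \<open>d > 0\<close> by (simp add: B'_def)
  moreover have "finite B'" using B(1) by (simp add: B'_def)
  ultimately show ?case
    using B g by (intro exI[of _ B'] exI[of _ "f * g"]) (auto simp: S_def)
qed

text \<open>A finite module over the domain \<open>S\<close> becomes free after inverting one element \<open>g\<close>: if \<open>b\<close> depends on
the independent elements found so far, its coefficient in the dependence relation goes into \<open>g\<close>.\<close>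

lemma lin_independent_subset:
  assumes "finite B"
  shows "\<exists>e g. finite e \<and> lin_independent S e \<and> g \<in> S \<and> g \<noteq> 0 \<and> e \<subseteq> B \<and> (\<forall>b\<in>B. g * b \<in> lin_span S e)"
  using assms
proof (induction B rule: finite_induct)
  case empty
  show ?case by (rule exI[of _ "{}"], rule exI[of _ 1]) (auto simp: S_def lin_independent_def)
next
  case (insert b B)
  then obtain e g where e: "finite e" "lin_independent S e" "g \<in> S" "g \<noteq> 0" "e \<subseteq> B"
    "\<And>b. b \<in> B \<Longrightarrow> g * b \<in> lin_span S e" by blast
  then have "b \<notin> e" using insert by auto
  show ?case
  proof (cases "lin_independent S (insert b e)")
    case True
    have mono: "x \<in> lin_span S (insert b e)" if "x \<in> lin_span S e" for x
      using lin_span_transfer[OF that, of 1 "insert b e"] e(1) by (auto simp: lin_span_base)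
    then have "g * b' \<in> lin_span S (insert b e)" if "b' \<in> insert b B" for b'
    proof (cases "b' = b")
      case True
      show ?thesis unfolding True by (intro lin_span_scale e(3) lin_span_base) (use e(1) in auto)
    next
      case False
      with that show ?thesis by (intro mono e(6)) auto
    qed
    then show ?thesis using True e by (intro exI[of _ "insert b e"] exI[of _ g]) auto
  next
    case False
    then obtain s where s: "\<And>c. c \<in> insert b e \<Longrightarrow> s c \<in> S" "(\<Sum>c\<in>insert b e. s c * c) = 0"
      "\<exists>c\<in>insert b e. s c \<noteq> 0" unfolding lin_independent_def by blast
    have eq: "s b * b = (\<Sum>c\<in>e. - s c * c)"
      using s(2) \<open>b \<notin> e\<close> e(1) by (simp add: sum_negf add_eq_0_iff)
    have "s b \<noteq> 0"
    proof
      assume "s b = 0"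
      then have "(\<Sum>c\<in>e. s c * c) = 0" using eq by (simp add: sum_negf)
      then have "\<forall>c\<in>e. s c = 0" using e(2) s(1) unfolding lin_independent_def by blast
      then show False using s(3) \<open>s b = 0\<close> by auto
    qed
    moreover have "s b * b \<in> lin_span S e"
      by (rule lin_spanI[OF _ eq]) (use s(1) in \<open>auto simp: S_def subring_generated_minus\<close>)
    then have "g * s b * b' \<in> lin_span S e" if "b' \<in> insert b B" for b'
      using that lin_span_scale[OF e(3), of "s b * b" e] lin_span_scale[OF s(1)[of b], of "g * b'" e] e(6)[of b']
      by (auto simp: algebra_simps)
    ultimately show ?thesis using e s(1)[of b]
      by (intro exI[of _ e] exI[of _ "g * s b"]) (auto simp: S_def)
  qed
qed

end

text \<open>The left regular representation of the ring generated by \<open>A\<close>: \<open>f ^ D * x\<close> acts on the module with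
basis \<open>e\<close> by a matrix over \<open>S = \<int>[T]\<close>. Its entries are polynomials in \<open>T\<close> whose degree is linear in
the degree \<open>D\<close> of \<open>x\<close> and whose norm grows exponentially in \<open>D\<close>, because multiplying by one
generator multiplies by one of finitely many fixed matrices.\<close>

lemma multiplication_table:
  assumes "finite A"
  obtains T e f c K where "alg_independent T" "finite e" "e \<noteq> {}"
    "lin_independent (subring_generated T) e" "f \<in> subring_generated T" "f \<noteq> 0"
    "\<And>D H x j. int_poly_value A D H x \<Longrightarrow> j \<in> e \<Longrightarrow>
       \<exists>s. (\<forall>l\<in>e. int_poly_value T (c * D) (K ^ D * H) (s l)) \<and> f ^ D * x * j = (\<Sum>l\<in>e. s l * l)"
proof -
  obtain T where T: "alg_independent T" "\<And>a. a \<in> A \<Longrightarrow> algebraic_over (subring_generated T) a"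
    using transcendence_basis[OF assms] by blast
  define S where "S = subring_generated T"
  obtain B f\<^sub>0 where B: "finite B" "1 \<in> B" "f\<^sub>0 \<in> S" "f\<^sub>0 \<noteq> 0"
    "\<And>a b. a \<in> A \<Longrightarrow> b \<in> B \<Longrightarrow> f\<^sub>0 * a * b \<in> lin_span S B"
    using common_spanning_set[OF assms T(2)] unfolding S_def by blast
  obtain e g where e: "finite e" "lin_independent S e" "g \<in> S" "g \<noteq> 0" "e \<subseteq> B"
    "\<And>b. b \<in> B \<Longrightarrow> g * b \<in> lin_span S e"
    using lin_independent_subset[OF B(1), of T] unfolding S_def by blast
  define f where "f = f\<^sub>0 * g"
  have f: "f \<in> S" "f \<noteq> 0" using B e by (auto simp: f_def S_def)
  have "e \<noteq> {}" using e(6)[OF B(2)] e(4) by (auto simp: lin_span_def)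
  have "\<exists>s. (\<forall>l\<in>e. s l \<in> S) \<and> f * a * j = (\<Sum>l\<in>e. s l * l)" if "a \<in> A" "j \<in> e" for a j
  proof -
    have "f\<^sub>0 * a * j \<in> lin_span S B" using that e(5) by (intro B) auto
    from lin_span_transfer[OF this[unfolded S_def], of g e] e(6)
    have "f * a * j \<in> lin_span S e"
      unfolding f_def S_def by (simp add: algebra_simps)
    then show ?thesis by (auto simp: lin_span_def)
  qed
  then obtain s where s: "\<And>a j l. a \<in> A \<Longrightarrow> j \<in> e \<Longrightarrow> l \<in> e \<Longrightarrow> s a j l \<in> S"
    "\<And>a j. a \<in> A \<Longrightarrow> j \<in> e \<Longrightarrow> f * a * j = (\<Sum>l\<in>e. s a j l * l)" by metis
  have "\<exists>D H. \<forall>i\<in>insert f ((\<lambda>(a, j, l). s a j l) ` (A \<times> e \<times> e)). int_poly_value T D H i"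
  proof (rule int_poly_value_uniform)
    fix i assume "i \<in> insert f ((\<lambda>(a, j, l). s a j l) ` (A \<times> e \<times> e))"
    then have "i \<in> S" using s(1) f(1) by auto
    then show "\<exists>D H. int_poly_value T D H i" by (simp add: S_def subring_generated_def)
  qed (use assms e(1) in auto)
  then obtain c H\<^sub>0 where cH: "\<forall>i\<in>insert f ((\<lambda>(a, j, l). s a j l) ` (A \<times> e \<times> e)). int_poly_value T c H\<^sub>0 i"
    by blast
  have bound_f: "int_poly_value T c H\<^sub>0 f" using cH by simp
  have bound_s: "int_poly_value T c H\<^sub>0 (s a j l)" if "a \<in> A" "j \<in> e" "l \<in> e" for a j l
    using cH that by force
  \<comment> \<open>one factor \<open>card e\<close> pays for the sum over \<open>e\<close> that each multiplication by a generator costs\<close>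
  define K where "K = card e * H\<^sub>0 + H\<^sub>0"
  have "\<exists>s. (\<forall>l\<in>e. int_poly_value T (c * D) (K ^ D * H) (s l)) \<and> f ^ D * x * j = (\<Sum>l\<in>e. s l * l)"
    if "int_poly_value A D H x" "j \<in> e" for D H x j
    using that(1)
  proof induction
    case zero
    show ?case by (rule exI[of _ "\<lambda>_. 0"]) (auto intro: int_poly_value.zero)
  next
    case one
    have "int_poly_value T 0 (Suc 0) 0" by (rule int_poly_value.mono[OF int_poly_value.zero]) auto
    then show ?case
      using \<open>j \<in> e\<close> e(1) int_poly_value.one[of T]
      by (intro exI[of _ "\<lambda>l. if l = j then 1 else 0"])
        (auto simp: if_distrib[of "\<lambda>x. x * _"] cong: if_cong)
  next
    case (gen a D H x)
    then obtain r where r: "\<And>l. l \<in> e \<Longrightarrow> int_poly_value T (c * D) (K ^ D * H) (r l)"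
      "f ^ D * x * j = (\<Sum>l\<in>e. r l * l)" by blast
    have "\<forall>k\<in>e. int_poly_value T (c * Suc D) (K ^ Suc D * H) (\<Sum>l\<in>e. s a l k * r l)"
    proof (rule ballI, rule int_poly_value.mono)
      fix k assume "k \<in> e"
      then show "int_poly_value T (c + c * D) (\<Sum>l\<in>e. H\<^sub>0 * (K ^ D * H)) (\<Sum>l\<in>e. s a l k * r l)"
        using gen(1) by (intro int_poly_value_sum e(1) int_poly_value_mult bound_s r)
    qed (auto simp: K_def algebra_simps)
    moreover have "f ^ Suc D * (a * x) * j = (\<Sum>k\<in>e. (\<Sum>l\<in>e. s a l k * r l) * k)"
    proof -
      have "f ^ Suc D * (a * x) * j = f * a * (f ^ D * x * j)" by simp
      also have "\<dots> = (\<Sum>l\<in>e. r l * (f * a * l))" unfolding r(2) by (simp add: sum_distrib_left algebra_simps)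
      also have "\<dots> = (\<Sum>l\<in>e. \<Sum>k\<in>e. s a l k * r l * k)"
        using s(2)[OF gen(1)] by (simp add: sum_distrib_left algebra_simps)
      also have "\<dots> = (\<Sum>k\<in>e. (\<Sum>l\<in>e. s a l k * r l) * k)"
        by (subst sum.swap) (simp add: sum_distrib_right)
      finally show ?thesis .
    qed
    ultimately show ?case by (intro exI[of _ "\<lambda>k. \<Sum>l\<in>e. s a l k * r l"] conjI)
  next
    case (add D H x H' y)
    from add.IH(1) obtain r where r: "\<And>l. l \<in> e \<Longrightarrow> int_poly_value T (c * D) (K ^ D * H) (r l)"
      "f ^ D * x * j = (\<Sum>l\<in>e. r l * l)" by blast
    from add.IH(2) obtain r' where r': "\<And>l. l \<in> e \<Longrightarrow> int_poly_value T (c * D) (K ^ D * H') (r' l)"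
      "f ^ D * y * j = (\<Sum>l\<in>e. r' l * l)" by blast
    show ?case
    proof (rule exI[of _ "\<lambda>l. r l + r' l"], intro conjI ballI)
      fix l assume "l \<in> e"
      from int_poly_value.add[OF r(1)[OF this] r'(1)[OF this]]
      show "int_poly_value T (c * D) (K ^ D * (H + H')) (r l + r' l)" by (simp add: distrib_left)
    qed (use r(2) r'(2) in \<open>simp add: sum.distrib distrib_left distrib_right\<close>)
  next
    case (minus D H x)
    then obtain r where
      "\<And>l. l \<in> e \<Longrightarrow> int_poly_value T (c * D) (K ^ D * H) (r l)" "f ^ D * x * j = (\<Sum>l\<in>e. r l * l)"
      by blast
    note r = this
    show ?case
    proof (rule exI[of _ "\<lambda>l. - r l"], intro conjI ballI)
      fix l assume "l \<in> e"
      from int_poly_value.minus[OF r(1)[OF this]]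
      show "int_poly_value T (c * D) (K ^ D * H) (- r l)" .
    qed (use r(2) in \<open>simp add: sum_negf\<close>)
  next
    case (mono D H x D' H')
    then obtain r where r: "\<And>l. l \<in> e \<Longrightarrow> int_poly_value T (c * D) (K ^ D * H) (r l)"
      "f ^ D * x * j = (\<Sum>l\<in>e. r l * l)" by blast
    have "\<forall>l\<in>e. int_poly_value T (c * D') (K ^ D' * H') (f ^ (D' - D) * r l)"
    proof (rule ballI, rule int_poly_value.mono)
      fix l assume "l \<in> e"
      then show "int_poly_value T ((D' - D) * c + c * D) (H\<^sub>0 ^ (D' - D) * (K ^ D * H)) (f ^ (D' - D) * r l)"
        by (intro int_poly_value_mult int_poly_value_power bound_f r)
      show "(D' - D) * c + c * D \<le> c * D'"
        using mono(2) by (simp add: diff_mult_distrib algebra_simps)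
      have "H\<^sub>0 ^ (D' - D) * (K ^ D * H) \<le> K ^ (D' - D) * (K ^ D * H')"
        by (intro mult_mono power_mono mono) (auto simp: K_def)
      also have "\<dots> = K ^ D' * H'" using mono(2) by (simp flip: power_add mult.assoc)
      finally show "H\<^sub>0 ^ (D' - D) * (K ^ D * H) \<le> K ^ D' * H'" .
    qed
    moreover have "f ^ D' * x * j = (\<Sum>l\<in>e. f ^ (D' - D) * r l * l)"
    proof -
      have "f ^ D' * x * j = f ^ (D' - D) * (f ^ D * x * j)"
        using mono(2) by (simp flip: power_add mult.assoc)
      then show ?thesis unfolding r(2) by (simp add: sum_distrib_left algebra_simps)
    qed
    ultimately show ?case by (intro exI[of _ "\<lambda>l. f ^ (D' - D) * r l"] conjI)
  qed
  then show ?thesis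
    using that[of T e f c K] T(1) e(1,2) \<open>e \<noteq> {}\<close> f unfolding S_def by blast
qed

section \<open>Small moduli that do not divide an integer\<close>

text \<open>The numbers \<open>1 / (m * (n choose m))\<close> form the Leibniz harmonic triangle. Each entry is the difference
of two entries of the column before it, so a common multiple of the denominators \<open>1, \<dots>, n\<close> in the first column
clears the denominators of the entire triangle down to row \<open>n\<close>.\<close>

lemma leibniz_triangle_Ints:
  fixes N :: int
  assumes "1 \<le> m" "m \<le> n" "\<And>q. q \<in> {1..n} \<Longrightarrow> int q dvd N"
  shows "of_int N / (of_nat m * of_nat (n choose m)) \<in> (\<int> :: real set)"
  using assms
proof (induction m arbitrary: n rule: nat_induct_at_least)
  case base
  then obtain k where "N = int n * k" by (auto elim!: dvdE)
  then show ?case using base by simp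
next
  case (Suc m n)
  then obtain n' where n: "n = Suc n'" by (cases n) auto
  have m: "m \<le> n'" "m \<ge> 1" using Suc n by auto
  have 1: "real (Suc m) * real (n choose Suc m) = real n * real (n' choose m)"
    using Suc_times_binomial_eq[of n' m] unfolding n of_nat_mult[symmetric] by simp
  have 2: "(real n - real m) * real (n choose m) = real n * real (n' choose m)"
  proof -
    have "real (n - m) * real (n choose m) = real n * real (n' choose m)"
      using binomial_absorb_comp[of n m] unfolding n of_nat_mult[symmetric] by simp
    moreover have "real (n - m) = real n - real m" using Suc.prems(1) by (intro of_nat_diff) simp
    ultimately show ?thesis by simp
  qed
  have pos: "real (n' choose m) > 0" "real (n choose m) > 0" "real n - real m > 0" "real n > 0" "real m > 0"
    using m Suc.prems n by auto
  \<comment> \<open>the recurrence that defines the Leibniz harmonic triangle\<close>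
  have eq: "of_int N / (real (Suc m) * real (n choose Suc m)) =
    of_int N / (real m * real (n' choose m)) - of_int N / (real m * real (n choose m))"
  proof -
    have 3: "real (n choose m) = real n * real (n' choose m) / (real n - real m)"
      using 2 pos by (simp add: field_simps)
    show ?thesis
      unfolding 1 3 using pos by (simp add: divide_simps) (simp add: algebra_simps)
  qed
  have "of_int N / (real m * real (n' choose m)) \<in> \<int>"
    by (rule Suc.IH) (use Suc.prems m n in auto)
  moreover have "of_int N / (real m * real (n choose m)) \<in> \<int>"
    by (rule Suc.IH) (use Suc.prems m n in auto)
  ultimately show ?case unfolding eq by (rule Ints_diff)
qed

text \<open>An exponential lower bound for the least common multiple of \<open>1, \<dots>, 2 * n\<close>: it is divisible by
\<open>n\<close> times the central binomial coefficient.\<close>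

lemma common_multiple_ge_power_2:
  fixes N :: int
  assumes "N \<noteq> 0" "\<And>q. q \<in> {1..2 * n} \<Longrightarrow> int q dvd N"
  shows "2 ^ n \<le> \<bar>N\<bar>"
proof (cases "n = 0")
  case False
  define k where "k = real n * real (2 * n choose n)"
  have "of_int N / k \<in> \<int>"
    unfolding k_def by (rule leibniz_triangle_Ints) (use assms False in auto)
  then obtain z where z: "of_int N / k = of_int z" by (auto elim: Ints_cases)
  have "(2 :: real) ^ n \<le> 4 ^ n / 2"
  proof -
    have "(2 :: real) ^ 1 \<le> 2 ^ n" using False by (intro power_increasing) auto
    then have "(2 :: real) ^ n * 2 \<le> 2 ^ n * 2 ^ n" by (intro mult_left_mono) auto
    then show ?thesis by (simp add: power_mult_distrib[symmetric])
  qed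
  also have "4 ^ n / 2 = real n * (4 ^ n / (2 * real n))" using False by simp
  also have "\<dots> \<le> k"
    unfolding k_def using False central_binomial_lower_bound[of n] by (intro mult_left_mono) auto
  finally have k: "2 ^ n \<le> k" .
  then have "k > 0" by (rule less_le_trans[rotated]) auto
  then have N: "of_int N = of_int z * k" using z by (simp add: field_simps)
  then have "z \<noteq> 0" using assms by auto
  then have "1 * k \<le> \<bar>of_int z\<bar> * k"
    using \<open>k > 0\<close> by (intro mult_right_mono) (auto simp flip: of_int_abs)
  also have "\<dots> = \<bar>of_int N\<bar>" using N \<open>k > 0\<close> by (simp add: abs_mult)
  finally have "2 ^ n \<le> real_of_int \<bar>N\<bar>" using k by simp
  then show ?thesis by (metis of_int_le_iff of_int_numeral of_int_power)
qed (use assms in auto)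

lemma small_prime_power_non_divisor:
  fixes N :: int
  assumes "N \<noteq> 0" "\<bar>N\<bar> < 2 ^ n"
  obtains p k :: nat where "prime p" "\<not> int (p ^ k) dvd N" "p ^ k \<le> 2 * n"
proof -
  obtain q where q: "q \<in> {1..2 * n}" "\<not> int q dvd N"
    using common_multiple_ge_power_2[OF assms(1), of n] assms(2) by force
  then have "\<not> q dvd nat \<bar>N\<bar>" by (simp add: int_dvd_int_iff[symmetric])
  then have "\<exists>p. prime p \<and> multiplicity p (nat \<bar>N\<bar>) < multiplicity p q"
  proof (rule contrapos_np)
    assume "\<not> (\<exists>p. prime p \<and> multiplicity p (nat \<bar>N\<bar>) < multiplicity p q)"
    then show "q dvd nat \<bar>N\<bar>"
      using q(1) by (intro multiplicity_le_imp_dvd) (auto simp: not_less)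
  qed
  then obtain p where p: "prime p" "multiplicity p (nat \<bar>N\<bar>) < multiplicity p q" by blast
  have "\<not> p ^ multiplicity p q dvd nat \<bar>N\<bar>"
    using p assms(1) by (subst power_dvd_iff_le_multiplicity) auto
  then have "\<not> int (p ^ multiplicity p q) dvd N"
    by (simp add: int_dvd_int_iff[symmetric] del: of_nat_power)
  moreover have "p ^ multiplicity p q \<le> q"
    using q by (intro dvd_imp_le multiplicity_dvd) auto
  ultimately show ?thesis using that p q by force
qed

text \<open>A prime power \<open>q = p ^ k \<le> 2 ^ L\<close> that does not divide \<open>s * f ^ L\<close> is coprime to \<open>f\<close>: otherwise
\<open>p ^ k\<close> divides \<open>f ^ k\<close>, and \<open>k \<le> L\<close>. The number \<open>s * f ^ L\<close> has about \<open>a * L\<close> bits, so \<open>L\<close> only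
has to be such that \<open>2 ^ L\<close> exceeds a multiple of \<open>a * L\<close>, and \<open>2 ^ L = O(a\<^sup>2)\<close> is ample.\<close>

lemma small_coprime_non_divisor:
  fixes s f :: int
  assumes "s \<noteq> 0" "f \<noteq> 0" "a \<ge> 1" "\<bar>s\<bar> \<le> 2 ^ a" "\<bar>f\<bar> \<le> 2 ^ a"
  obtains q :: nat where "q \<ge> 1" "coprime f (int q)" "\<not> int q dvd s" "q \<le> 64 * a\<^sup>2"
proof -
  obtain u where u: "2 ^ u \<le> a" "a < 2 ^ (u + 1)"
    using ex_power_ivl1[of 2 a] assms by auto
  \<comment> \<open>with \<open>2 ^ u \<le> a\<close> this gives \<open>2 ^ L = 64 * (2 ^ u)\<^sup>2 \<le> 64 * a\<^sup>2\<close>\<close>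
  define L where "L = 2 * u + 6"
  have "2 * u + 7 \<le> (2 :: nat) ^ (u + 4)"
  proof (induction u)
    case (Suc u)
    have "2 * Suc u + 7 \<le> 2 * (2 * u + 7)" by simp
    also have "\<dots> \<le> 2 * 2 ^ (u + 4)" by (intro mult_left_mono Suc.IH) simp
    finally show ?case by (simp only: add_Suc power_Suc)
  qed simp
  then have "a * (2 * u + 7) < 2 ^ (u + 1) * 2 ^ (u + 4)"
    using u by (intro mult_less_le_imp_less) auto
  moreover have "L - 1 = (u + 1) + (u + 4)" "L + 1 = 2 * u + 7" by (simp_all add: L_def)
  ultimately have aL: "a * (L + 1) < 2 ^ (L - 1)" by (simp only: power_add)
  have "\<bar>s * f ^ L\<bar> \<le> 2 ^ a * (2 ^ a) ^ L"
    unfolding abs_mult power_abs using assms by (intro mult_mono power_mono) auto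
  also have "\<dots> = 2 ^ (a * (L + 1))" by (simp add: power_mult[symmetric] power_add algebra_simps)
  also have "\<dots> < 2 ^ (2 ^ (L - 1))" using aL by (intro power_strict_increasing) auto
  finally obtain p k where pk: "prime p" "\<not> int (p ^ k) dvd s * f ^ L" "p ^ k \<le> 2 * 2 ^ (L - 1)"
    using small_prime_power_non_divisor[of "s * f ^ L"] assms by auto
  have "2 * 2 ^ (L - 1) = (2 :: nat) ^ L" by (simp add: L_def flip: power_Suc)
  then have pL: "p ^ k \<le> 2 ^ L" using pk by simp
  have "2 ^ k \<le> p ^ k" using prime_ge_2_nat[OF pk(1)] by (intro power_mono) auto
  then have kL: "k \<le> L" using pL by (meson le_trans power_le_imp_le_exp one_less_numeral_iff semiring_norm(76))
  have "coprime f (int p)"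
  proof (rule ccontr)
    assume "\<not> coprime f (int p)"
    then have "int p dvd f" using pk(1) by (metis coprime_commute prime_imp_coprime prime_nat_int_transfer)
    then have "int p ^ k dvd f ^ k" by (rule dvd_power_same)
    also have "f ^ k dvd f ^ L" using kL by (rule le_imp_power_dvd)
    finally show False using pk(2) by simp
  qed
  moreover have "2 ^ L \<le> 64 * a\<^sup>2"
  proof -
    have "(2 :: nat) ^ L = 64 * (2 ^ u)\<^sup>2" by (simp add: L_def power_add power_mult[symmetric] mult.commute)
    also have "\<dots> \<le> 64 * a\<^sup>2" using u by (intro mult_left_mono power_mono) auto
    finally show ?thesis .
  qed
  moreover have "1 \<le> p ^ k" using prime_gt_0_nat[OF pk(1)] by (simp add: Suc_le_eq)
  moreover have "\<not> int (p ^ k) dvd s" using pk(2) by auto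
  ultimately show ?thesis
    using that[of "p ^ k"] pL by (simp add: coprime_power_right_iff)
qed

section \<open>Ideals of polynomial index\<close>

definition ideal_of :: "complex set \<Rightarrow> complex set \<Rightarrow> bool" where
  "ideal_of R I \<longleftrightarrow> 0 \<in> I \<and> (\<forall>x\<in>I. \<forall>y\<in>I. x + y \<in> I) \<and> (\<forall>r\<in>R. \<forall>x\<in>I. r * x \<in> I)"

text \<open>The elements of \<open>R\<close> whose multiplication matrix over the fractions with denominators \<open>f ^ m\<close>
becomes zero under \<open>\<psi>\<close> modulo \<open>q\<close>. The power \<open>f ^ m\<close> on the left-hand side clears the
denominators.\<close>

definition congruence_ideal ::
  "complex set \<Rightarrow> complex set \<Rightarrow> complex set \<Rightarrow> complex \<Rightarrow> (complex \<Rightarrow> int) \<Rightarrow> int \<Rightarrow> complex set" where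
  "congruence_ideal R S e f \<psi> q =
     {y \<in> R. \<exists>m. \<forall>j\<in>e. \<exists>s. (\<forall>l\<in>e. s l \<in> S \<and> q dvd \<psi> (s l)) \<and> f ^ m * y * j = (\<Sum>l\<in>e. s l * l)}"

text \<open>Coprimality makes \<open>f\<close> invertible modulo \<open>q\<close>, so if \<open>e\<close> is linearly independent, then reducing the
multiplication matrices is a ring homomorphism to matrices over the integers modulo \<open>q\<close>, and
\<open>congruence_ideal\<close> is its kernel.\<close>

locale multiplication_table_mod =
  fixes A T e :: "complex set" and f :: complex and \<psi> :: "complex \<Rightarrow> int" and q :: int
  assumes finite_e: "finite e"
    and f_in: "f \<in> subring_generated T"
    and table: "\<And>x. x \<in> subring_generated A \<Longrightarrow>
      \<exists>D. \<forall>j\<in>e. \<exists>s. (\<forall>l\<in>e. s l \<in> subring_generated T) \<and> f ^ D * x * j = (\<Sum>l\<in>e. s l * l)"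
    and hom: "int_hom (subring_generated T) \<psi>"
    and q_pos: "q \<ge> 1"
    and coprime_f: "coprime (\<psi> f) q"
begin

abbreviation "R \<equiv> subring_generated A"
abbreviation "S \<equiv> subring_generated T"
abbreviation "I \<equiv> congruence_ideal R S e f \<psi> q"

lemmas \<psi>_simps = int_hom_add[OF hom] int_hom_mult[OF hom] int_hom_sum[OF hom] int_hom_power[OF hom]
  int_hom_diff[OF hom] int_hom_0[OF hom]

lemma congruence_ideal_scale:
  assumes "r \<in> R" "y \<in> I"
  shows "r * y \<in> I"
proof -
  obtain m where "\<forall>j\<in>e. \<exists>s. (\<forall>l\<in>e. s l \<in> S \<and> q dvd \<psi> (s l)) \<and> f ^ m * y * j = (\<Sum>l\<in>e. s l * l)"
    using assms(2) by (auto simp: congruence_ideal_def)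
  then obtain s where s: "\<And>j l. j \<in> e \<Longrightarrow> l \<in> e \<Longrightarrow> s j l \<in> S \<and> q dvd \<psi> (s j l)"
    "\<And>j. j \<in> e \<Longrightarrow> f ^ m * y * j = (\<Sum>l\<in>e. s j l * l)" by metis
  obtain D where "\<forall>j\<in>e. \<exists>s. (\<forall>l\<in>e. s l \<in> S) \<and> f ^ D * r * j = (\<Sum>l\<in>e. s l * l)"
    using table[OF assms(1)] by blast
  then obtain t where t: "\<And>j l. j \<in> e \<Longrightarrow> l \<in> e \<Longrightarrow> t j l \<in> S"
    "\<And>j. j \<in> e \<Longrightarrow> f ^ D * r * j = (\<Sum>l\<in>e. t j l * l)" by metis
  have "\<exists>s. (\<forall>l\<in>e. s l \<in> S \<and> q dvd \<psi> (s l)) \<and> f ^ (m + D) * (r * y) * j = (\<Sum>l\<in>e. s l * l)"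
    if j: "j \<in> e" for j
  proof (intro exI[of _ "\<lambda>k. \<Sum>l\<in>e. s j l * t l k"] conjI ballI)
    fix k assume k: "k \<in> e"
    show "(\<Sum>l\<in>e. s j l * t l k) \<in> S"
      using s(1) t(1) j k by (intro subring_generated_sum subring_generated_mult) auto
    have "\<psi> (\<Sum>l\<in>e. s j l * t l k) = (\<Sum>l\<in>e. \<psi> (s j l) * \<psi> (t l k))"
      using s(1)[OF j] t(1)[OF _ k] by (simp add: \<psi>_simps subring_generated_mult)
    also have "q dvd \<dots>" using s(1)[OF j] by (intro dvd_sum dvd_mult2) auto
    finally show "q dvd \<psi> (\<Sum>l\<in>e. s j l * t l k)" .
  next
    have "f ^ (m + D) * (r * y) * j = f ^ D * r * (f ^ m * y * j)" by (simp add: power_add)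
    also have "\<dots> = (\<Sum>l\<in>e. s j l * (f ^ D * r * l))"
      unfolding s(2)[OF j] by (simp add: sum_distrib_left algebra_simps)
    also have "\<dots> = (\<Sum>l\<in>e. \<Sum>k\<in>e. s j l * t l k * k)"
      by (intro sum.cong refl, subst t(2)) (simp_all only: sum_distrib_left mult.assoc)
    also have "\<dots> = (\<Sum>k\<in>e. (\<Sum>l\<in>e. s j l * t l k) * k)"
      by (subst sum.swap) (simp add: sum_distrib_right)
    finally show "f ^ (m + D) * (r * y) * j = (\<Sum>k\<in>e. (\<Sum>l\<in>e. s j l * t l k) * k)" .
  qed
  moreover have "r * y \<in> R" using assms by (auto simp: congruence_ideal_def)
  ultimately show ?thesis unfolding congruence_ideal_def by blast
qed

text \<open>Two expansions with different powers of \<open>f\<close> are brought to a common power.\<close>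

lemma coefficients_add_diff:
  assumes "\<forall>l\<in>e. s l \<in> S" "f ^ m * y * j = (\<Sum>l\<in>e. s l * l)"
    and "\<forall>l\<in>e. t l \<in> S" "f ^ n * z * j = (\<Sum>l\<in>e. t l * l)"
  shows "f ^ (m + n) * (y + z) * j = (\<Sum>l\<in>e. (f ^ n * s l + f ^ m * t l) * l)"
    and "f ^ (m + n) * (y - z) * j = (\<Sum>l\<in>e. (f ^ n * s l - f ^ m * t l) * l)"
    and "l \<in> e \<Longrightarrow> f ^ n * s l + f ^ m * t l \<in> S" "l \<in> e \<Longrightarrow> f ^ n * s l - f ^ m * t l \<in> S"
    and "l \<in> e \<Longrightarrow> \<psi> (f ^ n * s l + f ^ m * t l) = \<psi> f ^ n * \<psi> (s l) + \<psi> f ^ m * \<psi> (t l)"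
    and "l \<in> e \<Longrightarrow> \<psi> (f ^ n * s l - f ^ m * t l) = \<psi> f ^ n * \<psi> (s l) - \<psi> f ^ m * \<psi> (t l)"
proof -
  have "f ^ (m + n) * (y + z) * j = f ^ n * (f ^ m * y * j) + f ^ m * (f ^ n * z * j)"
    "f ^ (m + n) * (y - z) * j = f ^ n * (f ^ m * y * j) - f ^ m * (f ^ n * z * j)"
    by (simp_all add: power_add algebra_simps)
  then show "f ^ (m + n) * (y + z) * j = (\<Sum>l\<in>e. (f ^ n * s l + f ^ m * t l) * l)"
    "f ^ (m + n) * (y - z) * j = (\<Sum>l\<in>e. (f ^ n * s l - f ^ m * t l) * l)"
    unfolding assms(2,4) by (simp_all add: sum_distrib_left sum.distrib sum_subtractf algebra_simps)
  assume l: "l \<in> e"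
  have *: "f ^ n * s l \<in> S" "f ^ m * t l \<in> S"
    using assms(1,3) l f_in by auto
  then show "f ^ n * s l + f ^ m * t l \<in> S" "f ^ n * s l - f ^ m * t l \<in> S" by auto
  show "\<psi> (f ^ n * s l + f ^ m * t l) = \<psi> f ^ n * \<psi> (s l) + \<psi> f ^ m * \<psi> (t l)"
    "\<psi> (f ^ n * s l - f ^ m * t l) = \<psi> f ^ n * \<psi> (s l) - \<psi> f ^ m * \<psi> (t l)"
    using * assms(1,3) l f_in by (simp_all add: \<psi>_simps subring_generated_power)
qed

lemma congruence_ideal_ideal: "ideal_of R I"
  unfolding ideal_of_def
proof (intro conjI ballI congruence_ideal_scale)
  show "0 \<in> I"
    unfolding congruence_ideal_def
    by (auto intro!: exI[of _ 0] exI[of _ "\<lambda>_. 0"] simp: \<psi>_simps)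
next
  fix y z assume y: "y \<in> I" and z: "z \<in> I"
  obtain m where m: "\<forall>j\<in>e. \<exists>s. (\<forall>l\<in>e. s l \<in> S \<and> q dvd \<psi> (s l)) \<and> f ^ m * y * j = (\<Sum>l\<in>e. s l * l)"
    using y by (auto simp: congruence_ideal_def)
  obtain n where n: "\<forall>j\<in>e. \<exists>s. (\<forall>l\<in>e. s l \<in> S \<and> q dvd \<psi> (s l)) \<and> f ^ n * z * j = (\<Sum>l\<in>e. s l * l)"
    using z by (auto simp: congruence_ideal_def)
  have "\<exists>s. (\<forall>l\<in>e. s l \<in> S \<and> q dvd \<psi> (s l)) \<and> f ^ (m + n) * (y + z) * j = (\<Sum>l\<in>e. s l * l)"
    if "j \<in> e" for j
  proof -
    obtain s where s: "\<forall>l\<in>e. s l \<in> S \<and> q dvd \<psi> (s l)" "f ^ m * y * j = (\<Sum>l\<in>e. s l * l)"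
      using m \<open>j \<in> e\<close> by blast
    obtain t where t: "\<forall>l\<in>e. t l \<in> S \<and> q dvd \<psi> (t l)" "f ^ n * z * j = (\<Sum>l\<in>e. t l * l)"
      using n \<open>j \<in> e\<close> by blast
    have "\<forall>l\<in>e. s l \<in> S" "\<forall>l\<in>e. t l \<in> S" using s(1) t(1) by auto
    note c = coefficients_add_diff[OF this(1) s(2) this(2) t(2)]
    show ?thesis
      by (rule exI[of _ "\<lambda>l. f ^ n * s l + f ^ m * t l"]) (use c(1,3,5) s(1) t(1) in auto)
  qed
  moreover have "y + z \<in> R" using y z by (auto simp: congruence_ideal_def)
  ultimately show "y + z \<in> I" unfolding congruence_ideal_def by blast
qed

text \<open>The class of \<open>y\<close> is determined by its multiplication matrix modulo \<open>q\<close>, where division by \<open>f ^ m\<close>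
becomes multiplication by the \<open>m\<close>-th power of the inverse \<open>u\<close> of \<open>\<psi> f\<close>.\<close>

lemma congruence_ideal_index:
  obtains \<kappa> :: "complex \<Rightarrow> complex \<times> complex \<Rightarrow> int" and Y
  where "finite Y" "card Y = nat q ^ (card e)\<^sup>2" "\<And>y. y \<in> R \<Longrightarrow> \<kappa> y \<in> Y"
    "\<And>y z. y \<in> R \<Longrightarrow> z \<in> R \<Longrightarrow> \<kappa> y = \<kappa> z \<Longrightarrow> y - z \<in> I"
proof -
  obtain u where u: "[\<psi> f * u = 1] (mod q)" using cong_solve_coprime_int[OF coprime_f] by blast
  have "\<forall>y\<in>R. \<exists>D s. \<forall>j\<in>e. (\<forall>l\<in>e. s j l \<in> S) \<and> f ^ D * y * j = (\<Sum>l\<in>e. s j l * l)"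
    using table by metis
  then obtain m s where ms: "\<And>y j l. y \<in> R \<Longrightarrow> j \<in> e \<Longrightarrow> l \<in> e \<Longrightarrow> s y j l \<in> S"
    "\<And>y j. y \<in> R \<Longrightarrow> j \<in> e \<Longrightarrow> f ^ m y * y * j = (\<Sum>l\<in>e. s y j l * l)" by metis
  define \<kappa> where "\<kappa> y = restrict (\<lambda>(j, l). (u ^ m y * \<psi> (s y j l)) mod q) (e \<times> e)" for y
  define Y where "Y = (e \<times> e) \<rightarrow>\<^sub>E {0..<q}"
  show ?thesis
  proof (rule that[of Y \<kappa>])
    show "finite Y" using finite_e by (auto simp: Y_def intro!: finite_PiE)
    show "card Y = nat q ^ (card e)\<^sup>2"
      using finite_e by (simp add: Y_def card_PiE power2_eq_square card_cartesian_product)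
    show "\<kappa> y \<in> Y" for y using q_pos by (auto simp: \<kappa>_def Y_def)
    fix y z assume y: "y \<in> R" and z: "z \<in> R" and eq: "\<kappa> y = \<kappa> z"
    have "\<exists>r. (\<forall>l\<in>e. r l \<in> S \<and> q dvd \<psi> (r l)) \<and> f ^ (m y + m z) * (y - z) * j = (\<Sum>l\<in>e. r l * l)"
      if j: "j \<in> e" for j
    proof -
      have "\<forall>l\<in>e. s y j l \<in> S" "\<forall>l\<in>e. s z j l \<in> S" using ms(1) y z j by auto
      note c = coefficients_add_diff[OF this(1) ms(2)[OF y j] this(2) ms(2)[OF z j]]
      have "q dvd \<psi> (f ^ m z * s y j l - f ^ m y * s z j l)" if l: "l \<in> e" for l
      proof -
        have "\<kappa> y (j, l) = \<kappa> z (j, l)" using eq by simp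
        then have *: "[u ^ m y * \<psi> (s y j l) = u ^ m z * \<psi> (s z j l)] (mod q)"
          using j l by (simp add: \<kappa>_def cong_def)
        have one: "[(\<psi> f * u) ^ k = 1] (mod q)" for k using cong_pow[OF u, of k] by simp
        have "[\<psi> f ^ m z * \<psi> (s y j l) = (\<psi> f * u) ^ m y * (\<psi> f ^ m z * \<psi> (s y j l))] (mod q)"
          using cong_scalar_right[OF cong_sym[OF one[of "m y"]], of "\<psi> f ^ m z * \<psi> (s y j l)"] by simp
        also have "(\<psi> f * u) ^ m y * (\<psi> f ^ m z * \<psi> (s y j l)) =
            \<psi> f ^ m y * \<psi> f ^ m z * (u ^ m y * \<psi> (s y j l))"
          by (simp add: power_mult_distrib)
        also have "[\<dots> = \<psi> f ^ m y * \<psi> f ^ m z * (u ^ m z * \<psi> (s z j l))] (mod q)"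
          by (rule cong_scalar_left[OF *])
        also have "\<psi> f ^ m y * \<psi> f ^ m z * (u ^ m z * \<psi> (s z j l)) =
            (\<psi> f * u) ^ m z * (\<psi> f ^ m y * \<psi> (s z j l))"
          by (simp add: power_mult_distrib)
        also have "[\<dots> = \<psi> f ^ m y * \<psi> (s z j l)] (mod q)"
          using cong_scalar_right[OF one[of "m z"], of "\<psi> f ^ m y * \<psi> (s z j l)"] by simp
        finally show ?thesis using c(6)[OF l] by (simp add: cong_iff_dvd_diff)
      qed
      then show ?thesis
        by (intro exI[of _ "\<lambda>l. f ^ m z * s y j l - f ^ m y * s z j l"]) (use c(2,4) in auto)
    qed
    moreover have "y - z \<in> R" using y z by auto
    ultimately show "y - z \<in> I" unfolding congruence_ideal_def by blast
  qed
qed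

text \<open>Linear independence makes the coefficients unique up to a power of \<open>f\<close>, hence membership in the
ideal can be refuted with any single expansion.\<close>

lemma congruence_ideal_coeff_dvd:
  assumes "lin_independent S e" "f \<noteq> 0" "y \<in> I" "j \<in> e" "\<forall>l\<in>e. s l \<in> S"
    "f ^ D * y * j = (\<Sum>l\<in>e. s l * l)" "l \<in> e"
  shows "q dvd \<psi> (s l)"
proof -
  obtain m where "\<forall>j\<in>e. \<exists>s. (\<forall>l\<in>e. s l \<in> S \<and> q dvd \<psi> (s l)) \<and> f ^ m * y * j = (\<Sum>l\<in>e. s l * l)"
    using assms(3) by (auto simp: congruence_ideal_def)
  then obtain t where t: "\<forall>l\<in>e. t l \<in> S \<and> q dvd \<psi> (t l)" "f ^ m * y * j = (\<Sum>l\<in>e. t l * l)"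
    using assms(4) by blast
  have "\<forall>l\<in>e. t l \<in> S" using t(1) by auto
  note c = coefficients_add_diff[OF assms(5,6) this t(2)]
  have "(\<Sum>l\<in>e. (f ^ m * s l - f ^ D * t l) * l) = 0" using c(2) by simp
  then have "f ^ m * s l - f ^ D * t l = 0"
    using assms(1)[unfolded lin_independent_def, rule_format, of "\<lambda>l. f ^ m * s l - f ^ D * t l", OF c(4)]
      assms(7) by simp
  then have "\<psi> f ^ m * \<psi> (s l) = \<psi> f ^ D * \<psi> (t l)"
    using c(6)[OF assms(7)] by (simp add: \<psi>_simps)
  then have "q dvd \<psi> f ^ m * \<psi> (s l)" using t(1) assms(7) by simp
  moreover have "coprime q (\<psi> f ^ m)" using coprime_f by (simp add: coprime_commute)
  ultimately show ?thesis by (simp add: coprime_dvd_mult_right_iff)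
qed

end

lemma le_power_2: "(x :: int) \<le> 2 ^ nat x"
proof (cases "x \<ge> 0")
  case True
  have "nat x < 2 ^ nat x" by (rule less_exp)
  then have "int (nat x) < int (2 ^ nat x)" by (simp only: of_nat_less_iff)
  then show ?thesis using True by simp
next
  case False
  then show ?thesis by (auto intro: order_trans[of _ 0])
qed

text \<open>The bound on the index of the ideal is expressed by a labelling \<open>\<kappa>\<close> of the elements of \<open>R\<close>, with
equal labels only for congruent elements and with at most \<open>k\<close> labels in all. The labels that arise
are matrices of residues, with pairs of basis elements as indices.\<close>

definition avoided_by_ideal_of_index_le :: "complex set \<Rightarrow> nat \<Rightarrow> complex \<Rightarrow> bool" where
  "avoided_by_ideal_of_index_le R k x \<longleftrightarrow>
     (\<exists>I (\<kappa> :: complex \<Rightarrow> complex \<times> complex \<Rightarrow> int) Y. ideal_of R I \<and> x \<notin> I \<and>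
        finite Y \<and> card Y \<le> k \<and> (\<forall>y\<in>R. \<kappa> y \<in> Y) \<and>
        (\<forall>y\<in>R. \<forall>z\<in>R. \<kappa> y = \<kappa> z \<longrightarrow> y - z \<in> I))"

lemma avoided_by_ideal_of_index_leE:
  assumes "avoided_by_ideal_of_index_le R k x"
  obtains I Y and \<kappa> :: "complex \<Rightarrow> complex \<times> complex \<Rightarrow> int"
  where "ideal_of R I" "x \<notin> I" "finite Y" "card Y \<le> k" "\<And>y. y \<in> R \<Longrightarrow> \<kappa> y \<in> Y"
    "\<And>y z. y \<in> R \<Longrightarrow> z \<in> R \<Longrightarrow> \<kappa> y = \<kappa> z \<Longrightarrow> y - z \<in> I"
proof -
  obtain I and \<kappa> :: "complex \<Rightarrow> complex \<times> complex \<Rightarrow> int" and Y where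
    *: "ideal_of R I \<and> x \<notin> I \<and> finite Y \<and> card Y \<le> k \<and> (\<forall>y\<in>R. \<kappa> y \<in> Y) \<and>
      (\<forall>y\<in>R. \<forall>z\<in>R. \<kappa> y = \<kappa> z \<longrightarrow> y - z \<in> I)"
    using assms unfolding avoided_by_ideal_of_index_le_def by (elim exE)
  show ?thesis by (rule that[of I Y \<kappa>]) (use * in auto)
qed

text \<open>An effective form of the residual finiteness of finitely generated domains of characteristic
zero. The exponent \<open>d\<close> is four times the square of the rank of the module; it depends on \<open>A\<close> alone,
while the growth rate \<open>h\<close> of the coefficients affects the constant \<open>C\<close> only.\<close>

lemma polynomial_index_ideal:
  assumes "finite A"
  obtains d where "\<And>h. \<exists>C. \<forall>D\<ge>1. \<forall>x. int_poly_value A D (h ^ D) x \<longrightarrow> x \<noteq> 0 \<longrightarrow>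
    avoided_by_ideal_of_index_le (subring_generated A) (C * D ^ d) x"
proof -
  obtain T e f c K where T: "alg_independent T" and e: "finite e" "e \<noteq> {}"
    "lin_independent (subring_generated T) e" and f: "f \<in> subring_generated T" "f \<noteq> 0"
    and table: "\<And>D H x j. int_poly_value A D H x \<Longrightarrow> j \<in> e \<Longrightarrow>
       \<exists>s. (\<forall>l\<in>e. int_poly_value T (c * D) (K ^ D * H) (s l)) \<and> f ^ D * x * j = (\<Sum>l\<in>e. s l * l)"
    by (rule multiplication_table[OF assms], rule that) assumption+
  define S where "S = subring_generated T"
  obtain D\<^sub>f H\<^sub>f where DHf: "int_poly_value T D\<^sub>f H\<^sub>f f" using f(1) by (auto simp: subring_generated_def)
  obtain j where j: "j \<in> e" using e(2) by blast
  have "j \<noteq> 0"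
  proof
    assume "j = 0"
    then have "(\<Sum>l\<in>e. (if l = j then 1 else 0) * l) = 0" by (intro sum.neutral) auto
    moreover have "(if l = j then 1 else 0) \<in> subring_generated T" for l by simp
    ultimately have "(if j = j then 1 else 0) = (0 :: complex)"
      using e(3)[unfolded lin_independent_def, rule_format, of "\<lambda>l. if l = j then 1 else 0", OF _ _ j] by blast
    then show False by simp
  qed
  have table': "\<exists>D. \<forall>j\<in>e. \<exists>s. (\<forall>l\<in>e. s l \<in> S) \<and> f ^ D * x * j = (\<Sum>l\<in>e. s l * l)"
    if xA: "x \<in> subring_generated A" for x
  proof -
    obtain D H where "int_poly_value A D H x" using xA by (auto simp: subring_generated_def)
    note xD = this
    have "\<exists>s. (\<forall>l\<in>e. s l \<in> S) \<and> f ^ D * x * i = (\<Sum>l\<in>e. s l * l)" if "i \<in> e" for i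
    proof -
      obtain s where "\<forall>l\<in>e. int_poly_value T (c * D) (K ^ D * H) (s l)" "f ^ D * x * i = (\<Sum>l\<in>e. s l * l)"
        using table[OF xD \<open>i \<in> e\<close>] by blast
      then show ?thesis by (intro exI[of _ s]) (auto simp: S_def intro: subring_generatedI)
    qed
    then show ?thesis by blast
  qed
  define C where "C h = (64 * (K + h + (D\<^sub>f + c + 1) * (c + D\<^sub>f) + H\<^sub>f + 1)\<^sup>2) ^ (card e)\<^sup>2" for h
  have "avoided_by_ideal_of_index_le (subring_generated A) (C h * D ^ (4 * (card e)\<^sup>2)) x"
    if D: "D \<ge> 1" and x: "int_poly_value A D (h ^ D) x" "x \<noteq> 0" for D h x
  proof -
    obtain s where s: "\<And>l. l \<in> e \<Longrightarrow> int_poly_value T (c * D) (K ^ D * h ^ D) (s l)"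
      "f ^ D * x * j = (\<Sum>l\<in>e. s l * l)" using table[OF x(1) j] by blast
    have "f ^ D * x * j \<noteq> 0" using f(2) x(2) \<open>j \<noteq> 0\<close> by simp
    moreover have "(\<Sum>l\<in>e. s l * l) = 0" if "\<forall>l\<in>e. s l = 0"
      using that by (intro sum.neutral) auto
    ultimately obtain l where l: "l \<in> e" "s l \<noteq> 0" unfolding s(2) by blast
    \<comment> \<open>specializing the product keeps both \<open>f\<close> and the coefficient \<open>s l\<close> nonzero\<close>
    have "int_poly_value T (D\<^sub>f + c * D) (H\<^sub>f * (K ^ D * h ^ D)) (f * s l)"
      by (intro int_poly_value_mult DHf s l)
    moreover have "f * s l \<noteq> 0" using f(2) l(2) by simp
    ultimately obtain \<psi> where \<psi>: "int_hom S \<psi>" "\<psi> (f * s l) \<noteq> 0"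
      "\<And>t. t \<in> T \<Longrightarrow> \<bar>\<psi> t\<bar> \<le> int (D\<^sub>f + c * D)"
      using specialization[OF T] unfolding S_def by blast
    \<comment> \<open>\<open>M\<close> bounds the values of \<open>\<psi>\<close> on \<open>T\<close>, and \<open>a\<close> the binary logarithms of \<open>\<psi> (s l)\<close> and \<open>\<psi> f\<close>\<close>
    define M where "M = (D\<^sub>f + c + 1) * D"
    have "D\<^sub>f \<le> D\<^sub>f * D" using D by (cases D) auto
    moreover have "M = D\<^sub>f * D + c * D + D" by (simp add: M_def algebra_simps)
    ultimately have "D\<^sub>f + c * D \<le> M" "M \<ge> 1" using D by linarith+
    then have M: "\<bar>\<psi> t\<bar> \<le> int M" if "t \<in> T" for t
      using \<psi>(3)[OF that] \<open>D\<^sub>f + c * D \<le> M\<close> by linarith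
    have M1: "1 \<le> int M" using \<open>M \<ge> 1\<close> by simp
    define a where "a = (K + h + (D\<^sub>f + c + 1) * (c + D\<^sub>f) + H\<^sub>f + 1) * D\<^sup>2"
    have pow2: "int n ^ k \<le> 2 ^ (n * k)" for n k
      using power_mono[OF le_power_2[of "int n"], of k] by (simp add: power_mult)
    have DD: "D \<le> D\<^sup>2" "1 \<le> D\<^sup>2" using D by (auto simp: power2_eq_square)
    have "\<bar>\<psi> (s l)\<bar> \<le> int (K ^ D * h ^ D) * int M ^ (c * D)"
      using int_hom_bound[OF \<psi>(1)[unfolded S_def] s(1)[OF l(1)] M M1] .
    also have "\<dots> \<le> (2 ^ (K * D) * 2 ^ (h * D)) * 2 ^ (M * (c * D))"
      using pow2[of K D] pow2[of h D] by (simp only: of_nat_mult of_nat_power) (intro mult_mono pow2; simp)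
    also have "\<dots> = 2 ^ (K * D + h * D + M * (c * D))" by (simp add: power_add)
    also have "\<dots> \<le> 2 ^ a"
    proof (intro power_increasing)
      have "K * D + h * D + M * (c * D) \<le> K * D\<^sup>2 + h * D\<^sup>2 + (D\<^sub>f + c + 1) * c * D\<^sup>2"
        using DD by (intro add_mono mult_left_mono) (auto simp: M_def power2_eq_square algebra_simps)
      also have "\<dots> \<le> a" by (simp add: a_def algebra_simps)
      finally show "K * D + h * D + M * (c * D) \<le> a" .
    qed simp
    finally have bound_s: "\<bar>\<psi> (s l)\<bar> \<le> 2 ^ a" .
    have "\<bar>\<psi> f\<bar> \<le> int H\<^sub>f * int M ^ D\<^sub>f"
      using int_hom_bound[OF \<psi>(1)[unfolded S_def] DHf M M1] .
    also have "\<dots> \<le> 2 ^ (H\<^sub>f * 1) * 2 ^ (M * D\<^sub>f)"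
      using pow2[of H\<^sub>f 1] by (intro mult_mono pow2) auto
    also have "\<dots> = 2 ^ (H\<^sub>f + M * D\<^sub>f)" by (simp add: power_add)
    also have "\<dots> \<le> 2 ^ a"
    proof (intro power_increasing)
      have "M \<le> (D\<^sub>f + c + 1) * D\<^sup>2"
        unfolding M_def using DD by (intro mult_left_mono) auto
      then have "M * D\<^sub>f \<le> (D\<^sub>f + c + 1) * D\<^sup>2 * D\<^sub>f" by (rule mult_right_mono) simp
      moreover have "H\<^sub>f * 1 \<le> H\<^sub>f * D\<^sup>2" using DD by (intro mult_left_mono) auto
      moreover have "H\<^sub>f * D\<^sup>2 + (D\<^sub>f + c + 1) * D\<^sup>2 * D\<^sub>f \<le> a"
        by (simp add: a_def algebra_simps)
      ultimately show "H\<^sub>f + M * D\<^sub>f \<le> a" by linarith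
    qed simp
    finally have bound_f: "\<bar>\<psi> f\<bar> \<le> 2 ^ a" .
    have "a \<ge> 1" using DD by (simp add: a_def)
    have sl: "s l \<in> S" using s(1)[OF l(1)] by (auto simp: S_def intro: subring_generatedI)
    have "\<psi> (s l) \<noteq> 0" "\<psi> f \<noteq> 0"
      using \<psi>(2) int_hom_mult[OF \<psi>(1)[unfolded S_def] f(1)] sl by (auto simp: S_def)
    then obtain q where q: "q \<ge> 1" "coprime (\<psi> f) (int q)" "\<not> int q dvd \<psi> (s l)" "q \<le> 64 * a\<^sup>2"
      using small_coprime_non_divisor[OF _ _ \<open>a \<ge> 1\<close> bound_s bound_f] by metis
    interpret multiplication_table_mod A T e f \<psi> "int q"
      by unfold_locales (use e f table' \<psi>(1) q in \<open>auto simp: S_def\<close>)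
    have "x \<notin> I"
      using congruence_ideal_coeff_dvd[OF e(3) f(2) _ j _ s(2) l(1)] q(3) s(1)
      by (auto intro: subring_generatedI)
    obtain \<kappa> :: "complex \<Rightarrow> complex \<times> complex \<Rightarrow> int" and Y where
      Y: "finite Y" "card Y = nat (int q) ^ (card e)\<^sup>2" "\<And>y. y \<in> R \<Longrightarrow> \<kappa> y \<in> Y"
        "\<And>y z. y \<in> R \<Longrightarrow> z \<in> R \<Longrightarrow> \<kappa> y = \<kappa> z \<Longrightarrow> y - z \<in> I"
      by (rule congruence_ideal_index) blast
    have expand: "(64 * (b * D\<^sup>2)\<^sup>2) ^ k = (64 * b\<^sup>2) ^ k * D ^ (4 * k)" for b k :: nat
      by (simp add: power_mult_distrib power_mult[symmetric])
    have "card Y \<le> (64 * a\<^sup>2) ^ (card e)\<^sup>2" unfolding Y(2) nat_int using q(4) by (rule power_mono) simp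
    also have "\<dots> = C h * D ^ (4 * (card e)\<^sup>2)" unfolding a_def C_def by (rule expand)
    finally show ?thesis
      unfolding avoided_by_ideal_of_index_le_def
      using congruence_ideal_ideal \<open>x \<notin> I\<close> Y(1,3,4) by blast
  qed
  then show ?thesis by (intro that[of "4 * (card e)\<^sup>2"] exI allI impI)
qed

section \<open>Finite quotients from matrices modulo an ideal\<close>

text \<open>The definition of \<open>CD\<close> ranges over groups on natural numbers; a finite group of any type is
transported there by an enumeration of its elements.\<close>

lemma CD_le_card:
  fixes Q :: "('c, 'd) monoid_scheme"
  assumes "group Q" "finite (carrier Q)" "\<phi> \<in> hom G Q" "g \<in> carrier G" "h \<in> carrier G"
    and "\<not> is_conjugate Q (\<phi> g) (\<phi> h)"
  shows "CD G g h \<le> enat (card (carrier Q))"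
proof -
  interpret Q: group Q by fact
  obtain b where b: "bij_betw b (carrier Q) {0..<card (carrier Q)}"
    using ex_bij_betw_finite_nat[OF assms(2)] by blast
  then have inj: "inj_on b (carrier Q)" by (simp add: bij_betw_def)
  define N :: "nat monoid" where "N = \<lparr>carrier = UNIV,
    monoid.mult = (\<lambda>x y. b (inv_into (carrier Q) b x \<otimes>\<^bsub>Q\<^esub> inv_into (carrier Q) b y)), one = 0\<rparr>"
  define P where "P = N\<lparr>carrier := b ` carrier Q, one := b \<one>\<^bsub>Q\<^esub>\<rparr>"
  have "b \<in> hom Q N" by (auto simp: hom_def N_def inv_into_f_f[OF inj])
  then have group_P: "group P" unfolding P_def by (rule Q.hom_imp_img_group)
  have carrier_P: "carrier P = b ` carrier Q" by (simp add: P_def)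
  have b_hom: "b \<in> hom Q P"
    using \<open>b \<in> hom Q N\<close> by (auto simp: hom_def P_def)
  then interpret b: group_hom Q P b
    using group_P by (simp add: group_hom_def group_hom_axioms_def Q.group_axioms)
  have in_Q: "\<phi> g \<in> carrier Q" "\<phi> h \<in> carrier Q" using assms(3-5) by (auto simp: hom_def)
  have "\<not> is_conjugate P (b (\<phi> g)) (b (\<phi> h))"
  proof
    assume "is_conjugate P (b (\<phi> g)) (b (\<phi> h))"
    then obtain w where w: "w \<in> carrier Q" "b (\<phi> h) = b w \<otimes>\<^bsub>P\<^esub> b (\<phi> g) \<otimes>\<^bsub>P\<^esub> inv\<^bsub>P\<^esub> b w"
      by (auto simp: is_conjugate_def conj_class_def carrier_P)
    then have eq: "b (\<phi> h) = b (w \<otimes>\<^bsub>Q\<^esub> \<phi> g \<otimes>\<^bsub>Q\<^esub> inv\<^bsub>Q\<^esub> w)" using in_Q by simp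
    then have "\<phi> h = w \<otimes>\<^bsub>Q\<^esub> \<phi> g \<otimes>\<^bsub>Q\<^esub> inv\<^bsub>Q\<^esub> w"
      using inj_onD[OF inj eq] in_Q w(1) by simp
    then show False using assms(6) w(1) by (auto simp: is_conjugate_def conj_class_def)
  qed
  moreover have "b \<circ> \<phi> \<in> hom G P" using assms(3) b_hom by (auto simp: hom_def Pi_iff)
  moreover have "finite (carrier P)" "card (carrier P) = card (carrier Q)"
    using assms(2) inj by (auto simp: carrier_P card_image)
  ultimately have "enat (card (carrier Q)) \<in> {enat (card (carrier Q)) | (Q :: nat monoid) \<phi>.
    group Q \<and> finite (carrier Q) \<and> \<phi> \<in> hom G Q \<and> \<not> is_conjugate Q (\<phi> g) (\<phi> h)}"
    using group_P by (intro CollectI exI[of _ P] exI[of _ "b \<circ> \<phi>"]) auto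
  then show ?thesis unfolding CD_def by (rule Inf_lower)
qed

lemma trace_mat_eq: "A \<in> carrier_mat n n \<Longrightarrow> trace_mat A = (\<Sum>i<n. A $$ (i, i))"
  by (simp add: trace_mat_def)

locale matrix_rep = group G for G :: "('a, 'b) monoid_scheme" (structure) +
  fixes n :: nat and \<rho> :: "'a \<Rightarrow> complex mat"
  assumes dim: "x \<in> carrier G \<Longrightarrow> \<rho> x \<in> carrier_mat n n"
    and rho_mult: "x \<in> carrier G \<Longrightarrow> y \<in> carrier G \<Longrightarrow> \<rho> (x \<otimes> y) = \<rho> x * \<rho> y"
begin

lemma entry_mult:
  assumes "x \<in> carrier G" "y \<in> carrier G" "i < n" "j < n"
  shows "\<rho> (x \<otimes> y) $$ (i, j) = (\<Sum>k<n. \<rho> x $$ (i, k) * \<rho> y $$ (k, j))"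
  using assms dim[of x] dim[of y]
  by (simp add: rho_mult scalar_prod_def atLeast0LessThan)

lemma trace_commute:
  assumes "x \<in> carrier G" "y \<in> carrier G"
  shows "trace_mat (\<rho> (x \<otimes> y)) = trace_mat (\<rho> (y \<otimes> x))"
proof -
  have "trace_mat (\<rho> (x \<otimes> y)) = (\<Sum>i<n. \<Sum>k<n. \<rho> x $$ (i, k) * \<rho> y $$ (k, i))"
    using assms by (simp add: trace_mat_eq[OF dim] entry_mult)
  also have "\<dots> = (\<Sum>k<n. \<Sum>i<n. \<rho> y $$ (k, i) * \<rho> x $$ (i, k))"
    by (subst sum.swap) (simp add: mult.commute)
  also have "\<dots> = trace_mat (\<rho> (y \<otimes> x))"
    using assms by (simp add: trace_mat_eq[OF dim] entry_mult)
  finally show ?thesis .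
qed

lemma trace_conj_class:
  assumes "x \<in> carrier G" "y \<in> conj_class G x"
  shows "trace_mat (\<rho> y) = trace_mat (\<rho> x)"
proof -
  obtain w where w: "w \<in> carrier G" "y = w \<otimes> x \<otimes> inv w"
    using assms(2) by (auto simp: conj_class_def)
  have "trace_mat (\<rho> y) = trace_mat (\<rho> (inv w \<otimes> (w \<otimes> x)))"
    unfolding w(2) using w(1) assms(1) by (intro trace_commute) auto
  also have "inv w \<otimes> (w \<otimes> x) = x" using w(1) assms(1) by (simp add: m_assoc[symmetric])
  finally show ?thesis .
qed

end

text \<open>Reducing the entries of a representation modulo an ideal \<open>I\<close> of the coefficient ring \<open>R\<close>. Instead
of matrices over \<open>R / I\<close>, the congruence of entries modulo \<open>I\<close> is used, which defines the kernel of
the reduced representation directly.\<close>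

locale matrix_rep_mod_ideal = matrix_rep +
  fixes R I :: "complex set"
  assumes entries: "x \<in> carrier G \<Longrightarrow> i < n \<Longrightarrow> j < n \<Longrightarrow> \<rho> x $$ (i, j) \<in> R"
    and ideal: "ideal_of R I"
    and minus_1: "- 1 \<in> R"
begin

definition congr :: "'a \<Rightarrow> 'a \<Rightarrow> bool" where
  "congr x y \<longleftrightarrow> (\<forall>i<n. \<forall>j<n. \<rho> x $$ (i, j) - \<rho> y $$ (i, j) \<in> I)"

lemma I_0: "0 \<in> I"
  and I_add: "x \<in> I \<Longrightarrow> y \<in> I \<Longrightarrow> x + y \<in> I"
  and I_mult: "r \<in> R \<Longrightarrow> x \<in> I \<Longrightarrow> r * x \<in> I"
  using ideal by (auto simp: ideal_of_def)

lemma I_uminus: "x \<in> I \<Longrightarrow> - x \<in> I"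
  using I_mult[OF minus_1, of x] by simp

lemma I_sum: "(\<And>i. i \<in> F \<Longrightarrow> x i \<in> I) \<Longrightarrow> sum x F \<in> I"
  by (induction F rule: infinite_finite_induct) (auto simp: I_0 I_add)

lemma congr_refl: "congr x x"
  by (simp add: congr_def I_0)

lemma congr_sym:
  assumes "congr x y"
  shows "congr y x"
  unfolding congr_def
proof (intro allI impI)
  fix i j assume "i < n" "j < n"
  then have "- (\<rho> x $$ (i, j) - \<rho> y $$ (i, j)) \<in> I"
    using assms by (intro I_uminus) (simp add: congr_def)
  then show "\<rho> y $$ (i, j) - \<rho> x $$ (i, j) \<in> I" by simp
qed

lemma congr_mult:
  assumes "congr x x'" "congr y y'"
    and "x \<in> carrier G" "x' \<in> carrier G" "y \<in> carrier G" "y' \<in> carrier G"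
  shows "congr (x \<otimes> y) (x' \<otimes> y')"
  unfolding congr_def
proof (intro allI impI)
  fix i j assume ij: "i < n" "j < n"
  have "\<rho> (x \<otimes> y) $$ (i, j) - \<rho> (x' \<otimes> y') $$ (i, j) =
    (\<Sum>k<n. \<rho> y $$ (k, j) * (\<rho> x $$ (i, k) - \<rho> x' $$ (i, k)) +
      \<rho> x' $$ (i, k) * (\<rho> y $$ (k, j) - \<rho> y' $$ (k, j)))"
    using assms ij by (simp add: entry_mult sum_subtractf[symmetric] algebra_simps)
  also have "\<dots> \<in> I"
    using assms ij by (intro I_sum I_add I_mult entries) (auto simp: congr_def)
  finally show "\<rho> (x \<otimes> y) $$ (i, j) - \<rho> (x' \<otimes> y') $$ (i, j) \<in> I" .
qed

lemma congr_trace: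
  assumes "congr x y" "x \<in> carrier G" "y \<in> carrier G"
  shows "trace_mat (\<rho> x) - trace_mat (\<rho> y) \<in> I"
  using assms unfolding trace_mat_eq[OF dim[OF assms(2)]] trace_mat_eq[OF dim[OF assms(3)]]
  by (auto simp: congr_def simp flip: sum_subtractf intro!: I_sum)

definition congr_kernel :: "'a set" where
  "congr_kernel = {x \<in> carrier G. congr x \<one>}"

lemma congr_kernel_normal: "congr_kernel \<lhd> G"
  unfolding normal_inv_iff
proof (intro conjI ballI)
  show "subgroup congr_kernel G"
  proof
    fix x y assume "x \<in> congr_kernel" "y \<in> congr_kernel"
    then show "x \<otimes> y \<in> congr_kernel"
      using congr_mult[of x \<one> y \<one>] by (simp add: congr_kernel_def)
  next
    fix x assume "x \<in> congr_kernel"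
    then show "inv x \<in> congr_kernel"
      using congr_sym[OF congr_mult[OF congr_refl[of "inv x"], of x \<one>]]
      by (simp add: congr_kernel_def)
  qed (auto simp: congr_kernel_def congr_refl)
next
  fix x h assume "x \<in> carrier G" "h \<in> congr_kernel"
  then show "x \<otimes> h \<otimes> inv x \<in> congr_kernel"
    using congr_mult[OF congr_mult[OF congr_refl[of x], of h \<one>] congr_refl[of "inv x"]]
    by (simp add: congr_kernel_def)
qed

lemma congr_iff_coset:
  assumes "x \<in> carrier G" "y \<in> carrier G"
  shows "congr_kernel #> x = congr_kernel #> y \<longleftrightarrow> congr x y"
proof
  have sub: "subgroup congr_kernel G" using congr_kernel_normal by (simp add: normal_inv_iff)
  {
    assume "congr_kernel #> x = congr_kernel #> y"
    then have "x \<in> congr_kernel #> y" using assms rcos_self[OF assms(1) sub] by simp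
    then obtain z where z: "z \<in> congr_kernel" "x = z \<otimes> y" by (auto simp: r_coset_def)
    from z(1) have "z \<in> carrier G" "congr z \<one>" unfolding congr_kernel_def by blast+
    from congr_mult[OF this(2) congr_refl this(1) one_closed assms(2,2)]
    show "congr x y" unfolding z(2) l_one[OF assms(2)] .
  }
  assume "congr x y"
  then have "congr (x \<otimes> inv y) (y \<otimes> inv y)"
    using assms by (intro congr_mult congr_refl) simp_all
  then have "congr (x \<otimes> inv y) \<one>" using assms(2) by simp
  then have "x \<otimes> inv y \<in> congr_kernel" unfolding congr_kernel_def using assms by simp
  then have "x \<in> congr_kernel #> y"
    using assms unfolding r_coset_def
    by (intro UN_I[of "x \<otimes> inv y"]) (simp_all add: m_assoc)
  then show "congr_kernel #> x = congr_kernel #> y"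
    using repr_independence[OF _ assms(2) sub] by simp
qed

text \<open>The finite quotient is the group modulo the kernel of the reduced representation. Its elements
are told apart by the labels of the \<open>n * n\<close> matrix entries. If the images of \<open>g\<close> and \<open>h\<close> were
conjugate, then \<open>h\<close> would be congruent to a conjugate of \<open>g\<close>, and the traces would agree modulo
\<open>I\<close>.\<close>

lemma CD_le_index_power:
  fixes \<kappa> :: "complex \<Rightarrow> 'k"
  assumes Y: "finite Y" "\<And>y. y \<in> R \<Longrightarrow> \<kappa> y \<in> Y"
    and kappa: "\<And>y z. y \<in> R \<Longrightarrow> z \<in> R \<Longrightarrow> \<kappa> y = \<kappa> z \<Longrightarrow> y - z \<in> I"
    and gh: "g \<in> carrier G" "h \<in> carrier G" "trace_mat (\<rho> g) - trace_mat (\<rho> h) \<notin> I"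
  shows "CD G g h \<le> enat (card Y ^ (n * n))"
proof -
  interpret normal congr_kernel G by (rule congr_kernel_normal)
  define Z where "Z = ({..<n} \<times> {..<n}) \<rightarrow>\<^sub>E Y"
  define code where "code x = restrict (\<lambda>ij. \<kappa> (\<rho> x $$ ij)) ({..<n} \<times> {..<n})" for x
  have code_in: "code x \<in> Z" if "x \<in> carrier G" for x
    using that by (auto simp: code_def Z_def intro!: Y entries)
  have code_eq: "congr x y" if "x \<in> carrier G" "y \<in> carrier G" "code x = code y" for x y
    unfolding congr_def
  proof (intro allI impI)
    fix i j assume ij: "i < n" "j < n"
    have "code x (i, j) = code y (i, j)" using that(3) by simp
    then show "\<rho> x $$ (i, j) - \<rho> y $$ (i, j) \<in> I"
      using ij that by (intro kappa entries) (auto simp: code_def)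
  qed
  have "finite Z" using Y(1) by (auto simp: Z_def intro!: finite_PiE)
  have card_Z: "card Z = card Y ^ (n * n)"
    by (simp add: Z_def card_PiE card_cartesian_product)
  have carrier_Q: "carrier (G Mod congr_kernel) = (\<lambda>x. congr_kernel #> x) ` carrier G"
    by (auto simp: FactGroup_def RCOSETS_def)
  have "(\<lambda>x. congr_kernel #> x) ` carrier G \<subseteq>
    (\<lambda>z. congr_kernel #> (SOME x. x \<in> carrier G \<and> code x = z)) ` Z"
  proof (rule image_subsetI)
    fix x assume x: "x \<in> carrier G"
    define y where "y = (SOME y. y \<in> carrier G \<and> code y = code x)"
    have "y \<in> carrier G \<and> code y = code x" unfolding y_def by (rule someI[of _ x]) (use x in auto)
    then have "congr_kernel #> x = congr_kernel #> y"
      using x code_eq by (simp add: congr_iff_coset)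
    then show "congr_kernel #> x \<in> (\<lambda>z. congr_kernel #> (SOME x. x \<in> carrier G \<and> code x = z)) ` Z"
      using code_in[OF x] unfolding y_def by (intro image_eqI[of _ _ "code x"])
  qed
  from finite_surj[OF \<open>finite Z\<close> this] surj_card_le[OF \<open>finite Z\<close> this]
  have fin: "finite (carrier (G Mod congr_kernel))"
    and card: "card (carrier (G Mod congr_kernel)) \<le> card Y ^ (n * n)"
    by (simp_all only: carrier_Q card_Z)
  have "\<not> is_conjugate (G Mod congr_kernel) (congr_kernel #> g) (congr_kernel #> h)"
  proof
    assume "is_conjugate (G Mod congr_kernel) (congr_kernel #> g) (congr_kernel #> h)"
    then obtain w where w: "w \<in> carrier G" "congr_kernel #> h = (congr_kernel #> w)
      \<otimes>\<^bsub>G Mod congr_kernel\<^esub> (congr_kernel #> g) \<otimes>\<^bsub>G Mod congr_kernel\<^esub> inv\<^bsub>G Mod congr_kernel\<^esub> (congr_kernel #> w)"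
      by (auto simp: is_conjugate_def conj_class_def carrier_Q)
    interpret q: group_hom G "G Mod congr_kernel" "\<lambda>x. congr_kernel #> x"
      using factorgroup_is_group r_coset_hom_Mod
      by (simp add: group_hom_def group_hom_axioms_def group_axioms)
    have conj_in: "w \<otimes> g \<otimes> inv w \<in> carrier G" using w(1) gh by simp
    have "congr_kernel #> h = congr_kernel #> (w \<otimes> g \<otimes> inv w)"
      using w gh by simp
    with congr_iff_coset[OF gh(2) conj_in] have "congr h (w \<otimes> g \<otimes> inv w)" by (rule iffD1)
    then have "congr (w \<otimes> g \<otimes> inv w) h" by (rule congr_sym)
    then have "trace_mat (\<rho> (w \<otimes> g \<otimes> inv w)) - trace_mat (\<rho> h) \<in> I"
      using w(1) gh by (intro congr_trace) auto
    moreover have "w \<otimes> g \<otimes> inv w \<in> conj_class G g" using w(1) by (auto simp: conj_class_def)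
    ultimately show False using trace_conj_class[OF gh(1)] gh(3) by simp
  qed
  then have "CD G g h \<le> enat (card (carrier (G Mod congr_kernel)))"
    using CD_le_card[OF factorgroup_is_group fin r_coset_hom_Mod gh(1,2)] by blast
  also have "\<dots> \<le> enat (card Y ^ (n * n))" using card by simp
  finally show ?thesis .
qed

end

section \<open>Words and conjugacy classes\<close>

context group
begin

lemma foldr_mult_closed:
  "set w \<subseteq> carrier G \<Longrightarrow> z \<in> carrier G \<Longrightarrow> foldr (\<otimes>) w z \<in> carrier G"
  by (induction w) auto

lemma foldr_mult_eq:
  "set w \<subseteq> carrier G \<Longrightarrow> z \<in> carrier G \<Longrightarrow> foldr (\<otimes>) w z = foldr (\<otimes>) w \<one> \<otimes> z"
  by (induction w) (auto simp: m_assoc foldr_mult_closed)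

lemma symmetrized_subset: "X \<subseteq> carrier G \<Longrightarrow> X \<union> (\<lambda>x. inv x) ` X \<subseteq> carrier G"
  by auto

lemma generate_word:
  assumes "x \<in> generate G X" "X \<subseteq> carrier G"
  shows "\<exists>w. set w \<subseteq> X \<union> (\<lambda>x. inv x) ` X \<and> foldr (\<otimes>) w \<one> = x"
  using assms(1)
proof induction
  case one
  show ?case by (rule exI[of _ "[]"]) auto
next
  case (incl h)
  then show ?case using assms(2) by (intro exI[of _ "[h]"]) auto
next
  case (inv h)
  then show ?case using assms(2) by (intro exI[of _ "[inv h]"]) auto
next
  case (eng x y)
  then obtain v w where vw: "set v \<subseteq> X \<union> (\<lambda>x. inv x) ` X" "foldr (\<otimes>) v \<one> = x"
    "set w \<subseteq> X \<union> (\<lambda>x. inv x) ` X" "foldr (\<otimes>) w \<one> = y" by blast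
  have "foldr (\<otimes>) (v @ w) \<one> = x \<otimes> y"
    using foldr_mult_eq[of v y] foldr_mult_closed[of w \<one>] vw symmetrized_subset[OF assms(2)] by auto
  then show ?case using vw by (intro exI[of _ "v @ w"]) auto
qed

lemma word_length_word:
  assumes "finite_generating_set G X" "x \<in> carrier G"
  shows "\<exists>w. length w = word_length G X x \<and> set w \<subseteq> X \<union> (\<lambda>x. inv x) ` X \<and> foldr (\<otimes>) w \<one> = x"
proof -
  have "\<exists>n w. length w = n \<and> set w \<subseteq> X \<union> (\<lambda>x. inv x) ` X \<and> foldr (\<otimes>) w \<one> = x"
    using generate_word[of x X] assms by (auto simp: finite_generating_set_def)
  then show ?thesis unfolding word_length_def by (rule LeastI_ex)
qed

lemma word_length_le:
  "set w \<subseteq> X \<union> (\<lambda>x. inv x) ` X \<Longrightarrow> foldr (\<otimes>) w \<one> = x \<Longrightarrow> word_length G X x \<le> length w"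
  unfolding word_length_def by (rule Least_le) blast

lemma conj_class_self: "x \<in> carrier G \<Longrightarrow> x \<in> conj_class G x"
  unfolding conj_class_def by (auto intro!: exI[of _ \<one>])

lemma conj_class_closed: "x \<in> carrier G \<Longrightarrow> y \<in> conj_class G x \<Longrightarrow> y \<in> carrier G"
  by (auto simp: conj_class_def)

lemma conj_class_sym:
  assumes "x \<in> carrier G" "y \<in> conj_class G x"
  shows "x \<in> conj_class G y"
proof -
  obtain w where "w \<in> carrier G" "y = w \<otimes> x \<otimes> inv w" using assms(2) by (auto simp: conj_class_def)
  moreover from this have "inv w \<otimes> (w \<otimes> x) = x" using assms(1) by (simp flip: m_assoc)
  ultimately have "x = inv w \<otimes> y \<otimes> inv (inv w)" "inv w \<in> carrier G"
    using assms(1) by (simp_all add: m_assoc)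
  then show ?thesis unfolding conj_class_def by blast
qed

lemma conj_class_trans:
  assumes "x \<in> carrier G" "y \<in> conj_class G x" "z \<in> conj_class G y"
  shows "z \<in> conj_class G x"
proof -
  obtain v w where "v \<in> carrier G" "y = v \<otimes> x \<otimes> inv v" "w \<in> carrier G" "z = w \<otimes> y \<otimes> inv w"
    using assms(2,3) by (auto simp: conj_class_def)
  then have "z = (w \<otimes> v) \<otimes> x \<otimes> inv (w \<otimes> v)" "w \<otimes> v \<in> carrier G"
    using assms(1) by (simp_all add: m_assoc inv_mult_group)
  then show ?thesis unfolding conj_class_def by blast
qed

lemma conj_class_eq_iff:
  assumes "x \<in> carrier G" "y \<in> carrier G"
  shows "conj_class G x = conj_class G y \<longleftrightarrow> is_conjugate G x y"
  unfolding is_conjugate_def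
  using assms conj_class_self[of y] conj_class_sym[of x y] conj_class_trans[of x y] conj_class_trans[of y x]
  by blast

lemma conj_class_one: "conj_class G \<one> = {\<one>}"
  by (auto simp: conj_class_def intro!: exI[of _ \<one>])

lemma class_length_le:
  assumes "x \<in> carrier G"
  shows "class_length G X (conj_class G x) \<le> word_length G X x"
  unfolding class_length_def by (rule Least_le) (use conj_class_self[OF assms] in blast)

lemma class_ball_short_word:
  assumes "finite_generating_set G X" "h \<in> carrier G" "conj_class G h \<in> class_ball G X m"
  obtains w where "set w \<subseteq> X \<union> (\<lambda>x. inv x) ` X" "length w \<le> m" "foldr (\<otimes>) w \<one> \<in> conj_class G h"
proof -
  have "\<exists>n. \<exists>g \<in> conj_class G h. word_length G X g = n" using conj_class_self[OF assms(2)] by blast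
  from LeastI_ex[OF this] obtain x where x: "x \<in> conj_class G h"
    "word_length G X x = class_length G X (conj_class G h)" unfolding class_length_def by blast
  have "word_length G X x \<le> m" using x(2) assms(3) by (simp add: class_ball_def)
  then show ?thesis
    using word_length_word[OF assms(1) conj_class_closed[OF assms(2) x(1)]] x(1) that by auto
qed

text \<open>This makes the maximum in the definition of \<open>Conj\<close> one over a nonempty set. If the class of \<open>g\<close> is
not trivial, the identity serves; otherwise a nontrivial generator does, which exists because
the group is infinite.\<close>

lemma unit_ball_not_one_class:
  assumes "infinite (carrier G)" "finite_generating_set G X" "g \<in> carrier G" "m \<ge> 1"
  shows "\<exists>h\<in>carrier G. conj_class G h \<in> class_ball G X m \<and> conj_class G h \<noteq> conj_class G g"
proof (cases "conj_class G \<one> = conj_class G g")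
  case False
  have "word_length G X \<one> \<le> length ([] :: 'a list)" by (rule word_length_le) auto
  then have "conj_class G \<one> \<in> class_ball G X m"
    using class_length_le[of \<one> X] by (auto simp: class_ball_def conj_classes_def)
  then show ?thesis using False by blast
next
  case True
  have X: "X \<subseteq> carrier G" "generate G X = carrier G" using assms(2) by (auto simp: finite_generating_set_def)
  have "\<not> X \<subseteq> {\<one>}"
  proof
    assume "X \<subseteq> {\<one>}"
    have "x = \<one>" if "x \<in> generate G X" for x
      using that by induction (use \<open>X \<subseteq> {\<one>}\<close> in auto)
    then have "carrier G \<subseteq> {\<one>}" using X(2) by blast
    then show False using assms(1) finite_subset by blast
  qed
  then obtain x where x: "x \<in> X" "x \<noteq> \<one>" by blast
  then have xG: "x \<in> carrier G" using X by blast
  have "word_length G X x \<le> length [x]" by (rule word_length_le) (use x xG in auto)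
  then have "conj_class G x \<in> class_ball G X m"
    using class_length_le[OF xG, of X] assms(4) xG by (auto simp: class_ball_def conj_classes_def)
  moreover have "conj_class G x \<noteq> conj_class G g"
    using x(2) conj_class_self[OF xG] True conj_class_one by auto
  ultimately show ?thesis using xG by blast
qed

end

section \<open>Polynomial bound for conjugacy separability\<close>

text \<open>The image of the identity is idempotent, and it is invertible because its determinant is \<open>1\<close>.\<close>

lemma SL_hom_one:
  assumes "group G" "\<rho> \<in> hom G (SL n)"
  shows "\<rho> \<one>\<^bsub>G\<^esub> = 1\<^sub>m n"
proof -
  interpret group G by fact
  define P where "P = \<rho> \<one>\<^bsub>G\<^esub>"
  have P: "P \<in> carrier_mat n n" "det P = 1"
    using assms(2) by (auto simp: hom_def SL_def P_def)
  have "P * P = P"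
    using hom_mult[OF assms(2) one_closed one_closed] by (simp add: P_def SL_def)
  note adj = adj_mat[OF P(1)]
  have inverse: "adj_mat P * P = 1\<^sub>m n"
    using adj(3) P(2) by (auto intro!: eq_matI)
  then have "P = (adj_mat P * P) * P" using P(1) by simp
  also have "\<dots> = adj_mat P * P" using adj(1) P(1) \<open>P * P = P\<close> by (simp add: assoc_mult_mat[of _ n n _ n _ n])
  also have "\<dots> = 1\<^sub>m n" by (rule inverse)
  finally show ?thesis by (simp add: P_def)
qed

context matrix_rep
begin

text \<open>Each entry of a product of \<open>k\<close> matrices is a sum of at most \<open>n ^ k\<close> products of \<open>k\<close> entries, which
accounts for the linear degree and the exponential norm.\<close>

lemma foldr_entries_int_poly_value:
  assumes "\<rho> \<one> = 1\<^sub>m n" "W \<subseteq> carrier G"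
    and "\<And>x i j. x \<in> W \<Longrightarrow> i < n \<Longrightarrow> j < n \<Longrightarrow> int_poly_value A c h (\<rho> x $$ (i, j))"
    and "set w \<subseteq> W" "i < n" "j < n"
  shows "int_poly_value A (c * length w) ((n * h) ^ length w) (\<rho> (foldr (\<otimes>) w \<one>) $$ (i, j))"
  using assms(4-6)
proof (induction w arbitrary: i j)
  case Nil
  then show ?case
    using assms(1) int_poly_value.one[of A] int_poly_value.mono[OF int_poly_value.zero[of A], of 0 1]
    by auto
next
  case (Cons x w)
  have x: "x \<in> W" "x \<in> carrier G" and w: "set w \<subseteq> W" using Cons.prems assms(2) by auto
  then have "foldr (\<otimes>) w \<one> \<in> carrier G" using assms(2) by (intro foldr_mult_closed) auto
  then have "\<rho> (foldr (\<otimes>) (x # w) \<one>) $$ (i, j) =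
      (\<Sum>k<n. \<rho> x $$ (i, k) * \<rho> (foldr (\<otimes>) w \<one>) $$ (k, j))"
    using x Cons.prems by (simp add: entry_mult)
  also have "int_poly_value A (c + c * length w) (\<Sum>k<n. h * (n * h) ^ length w) \<dots>"
    using Cons.prems by (intro int_poly_value_sum int_poly_value_mult assms(3) Cons.IH x w) auto
  finally show ?case by (simp add: algebra_simps)
qed

end

theorem theorem1p5:
  fixes G :: "('a, 'b) monoid_scheme"
  assumes "group G"
    and "infinite (carrier G)"
    and "finitely_generated_group G"
    and "property_B G"
  shows "\<forall>g \<in> carrier G. \<exists>d::nat. d \<ge> 1 \<and>
           (\<forall>X. finite_generating_set G X \<longrightarrow> Conj G g X \<preceq> (\<lambda>n. enat (n ^ d)))"
proof
  interpret group G by fact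
  fix g assume g: "g \<in> carrier G"
  obtain n \<rho> where \<rho>: "\<rho> \<in> hom G (SL n)"
    and sep: "\<And>h. h \<in> carrier G \<Longrightarrow> \<not> is_conjugate G g h \<Longrightarrow> trace_mat (\<rho> g) \<noteq> trace_mat (\<rho> h)"
    using assms(4) g unfolding property_B_def by blast
  interpret matrix_rep G n \<rho>
    using \<rho> by unfold_locales (auto simp: hom_def SL_def)
  note rho_1 = SL_hom_one[OF assms(1) \<rho>]
  obtain X\<^sub>0 where X\<^sub>0: "finite_generating_set G X\<^sub>0"
    using assms(3) by (auto simp: finitely_generated_group_def)
  define sym where "sym X = X \<union> (\<lambda>x. inv\<^bsub>G\<^esub> x) ` X" for X
  have sym: "finite (sym X)" "sym X \<subseteq> carrier G" if "finite_generating_set G X" for X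
    using that by (auto simp: sym_def finite_generating_set_def)
  define A where "A = (\<lambda>(x, i, j). \<rho> x $$ (i, j)) ` (sym X\<^sub>0 \<times> {..<n} \<times> {..<n})"
  have "finite A" using sym(1)[OF X\<^sub>0] by (auto simp: A_def)
  have "int_poly_value A 1 1 a" if "a \<in> A" for a
    using int_poly_value.gen[OF that int_poly_value.one] by simp
  then have gens: "int_poly_value A 1 1 (\<rho> x $$ (i, j))" if "x \<in> sym X\<^sub>0" "i < n" "j < n" for x i j
    using that by (force simp: A_def)
  have entries: "\<rho> x $$ (i, j) \<in> subring_generated A" if x: "x \<in> carrier G" and "i < n" "j < n" for x i j
  proof -
    obtain w where "set w \<subseteq> sym X\<^sub>0" "foldr (\<otimes>\<^bsub>G\<^esub>) w \<one>\<^bsub>G\<^esub> = x"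
      using word_length_word[OF X\<^sub>0 x] by (auto simp: sym_def)
    then show ?thesis
      using foldr_entries_int_poly_value[OF rho_1 sym(2)[OF X\<^sub>0] gens, of w i j] that(2,3)
      by (auto intro: subring_generatedI)
  qed
  obtain d where d: "\<And>h. \<exists>C. \<forall>D\<ge>1. \<forall>x. int_poly_value A D (h ^ D) x \<longrightarrow> x \<noteq> 0 \<longrightarrow>
    avoided_by_ideal_of_index_le (subring_generated A) (C * D ^ d) x"
    using polynomial_index_ideal[OF \<open>finite A\<close>] by blast
  obtain D\<^sub>g H\<^sub>g where trace_g: "int_poly_value A D\<^sub>g H\<^sub>g (trace_mat (\<rho> g))"
  proof -
    have "trace_mat (\<rho> g) \<in> subring_generated A"
      unfolding trace_mat_eq[OF dim[OF g]] using g by (intro subring_generated_sum entries) auto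
    then show ?thesis using that by (auto simp: subring_generated_def)
  qed
  have "Conj G g X \<preceq> (\<lambda>m. enat (m ^ (d * (n * n) + 1)))" if X: "finite_generating_set G X" for X
  proof -
    have "\<exists>c h. \<forall>t\<in>sym X \<times> {..<n} \<times> {..<n}. int_poly_value A c h ((\<lambda>(x, i, j). \<rho> x $$ (i, j)) t)"
    proof (rule int_poly_value_uniform)
      fix t assume "t \<in> sym X \<times> {..<n} \<times> {..<n}"
      then have "(\<lambda>(x, i, j). \<rho> x $$ (i, j)) t \<in> subring_generated A"
        using sym(2)[OF X] entries by auto
      then show "\<exists>D H. int_poly_value A D H ((\<lambda>(x, i, j). \<rho> x $$ (i, j)) t)"
        by (simp add: subring_generated_def)
    qed (use sym(1)[OF X] in auto)
    then obtain c h\<^sub>0 where ch: "\<And>x i j. x \<in> sym X \<Longrightarrow> i < n \<Longrightarrow> j < n \<Longrightarrow> int_poly_value A c h\<^sub>0 (\<rho> x $$ (i, j))"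
      by fastforce
    \<comment> \<open>chosen so that \<open>H\<^sub>g + n * (n * h\<^sub>0 + 1) ^ m \<le> h ^ m\<close> for all \<open>m \<ge> 1\<close>, which bounds
      the norm of the difference of traces\<close>
    define h where "h = (n + H\<^sub>g + 1) * (n * h\<^sub>0 + 1)"
    obtain C where C: "\<And>D x. D \<ge> 1 \<Longrightarrow> int_poly_value A D (h ^ D) x \<Longrightarrow> x \<noteq> 0 \<Longrightarrow>
      avoided_by_ideal_of_index_le (subring_generated A) (C * D ^ d) x"
      using d[of h] by blast
    define c' where "c' = c + D\<^sub>g + 1"
    define B where "B = (C * c' ^ d) ^ (n * n)"
    have CD: "CD G g y \<le> enat (B * m ^ (d * (n * n)))"
      if m: "m \<ge> 1" and y: "y \<in> carrier G" "conj_class G y \<in> class_ball G X m"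
        "conj_class G y \<noteq> conj_class G g" for m y
    proof -
      obtain w where w: "set w \<subseteq> sym X" "length w \<le> m" "foldr (\<otimes>\<^bsub>G\<^esub>) w \<one>\<^bsub>G\<^esub> \<in> conj_class G y"
        using class_ball_short_word[OF X y(1,2)] unfolding sym_def by metis
      define z where "z = foldr (\<otimes>\<^bsub>G\<^esub>) w \<one>\<^bsub>G\<^esub>"
      have z: "z \<in> carrier G" using w(3) y(1) by (simp add: z_def conj_class_closed)
      define x where "x = trace_mat (\<rho> g) - trace_mat (\<rho> z)"
      have x_y: "x = trace_mat (\<rho> g) - trace_mat (\<rho> y)"
        using trace_conj_class[OF y(1) w(3)] by (simp add: x_def z_def)
      have "\<not> is_conjugate G g y" using y(1,3) g by (simp flip: conj_class_eq_iff)
      then have "x \<noteq> 0" using sep[OF y(1)] x_y by simp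
      have "1 \<le> c' * m" using m by (simp add: c'_def)
      have "int_poly_value A (c * length w) (\<Sum>i<n. (n * h\<^sub>0) ^ length w) (trace_mat (\<rho> z))"
        unfolding trace_mat_eq[OF dim[OF z]] unfolding z_def
        by (intro int_poly_value_sum foldr_entries_int_poly_value[OF rho_1 sym(2)[OF X] ch w(1)]) auto
      then have "int_poly_value A (c' * m) (n * (n * h\<^sub>0 + 1) ^ m) (trace_mat (\<rho> z))"
      proof (rule int_poly_value.mono)
        have "(n * h\<^sub>0) ^ length w \<le> (n * h\<^sub>0 + 1) ^ length w" by (intro power_mono) auto
        also have "\<dots> \<le> (n * h\<^sub>0 + 1) ^ m" using w(2) by (intro power_increasing) auto
        finally show "(\<Sum>i<n. (n * h\<^sub>0) ^ length w) \<le> n * (n * h\<^sub>0 + 1) ^ m" by simp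
        show "c * length w \<le> c' * m" using w(2) by (intro mult_mono) (auto simp: c'_def)
      qed
      moreover have "int_poly_value A (c' * m) H\<^sub>g (trace_mat (\<rho> g))"
      proof (rule int_poly_value.mono[OF trace_g])
        have "D\<^sub>g * 1 \<le> c' * m" using m by (intro mult_mono) (auto simp: c'_def)
        then show "D\<^sub>g \<le> c' * m" by simp
      qed simp
      ultimately have "int_poly_value A (c' * m) (H\<^sub>g + n * (n * h\<^sub>0 + 1) ^ m) x"
        unfolding x_def using int_poly_value.add[OF _ int_poly_value.minus] by fastforce
      then have "int_poly_value A (c' * m) (h ^ (c' * m)) x"
      proof (rule int_poly_value.mono)
        define u where "u = (n * h\<^sub>0 + 1) ^ m"
        have "H\<^sub>g * 1 \<le> H\<^sub>g * u" by (intro mult_left_mono) (auto simp: u_def)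
        moreover have "(n + H\<^sub>g + 1) * u = n * u + H\<^sub>g * u + u" by (simp add: algebra_simps)
        ultimately have "H\<^sub>g + n * u \<le> (n + H\<^sub>g + 1) * u" by linarith
        then have "H\<^sub>g + n * (n * h\<^sub>0 + 1) ^ m \<le> (n + H\<^sub>g + 1) * (n * h\<^sub>0 + 1) ^ m"
          unfolding u_def .
        also have "\<dots> \<le> (n + H\<^sub>g + 1) ^ m * (n * h\<^sub>0 + 1) ^ m"
          using m self_le_power[of "n + H\<^sub>g + 1" m] by (intro mult_right_mono) auto
        also have "\<dots> = h ^ m" by (simp only: h_def power_mult_distrib)
        also have "\<dots> \<le> h ^ (c' * m)" by (intro power_increasing) (auto simp: h_def c'_def)
        finally show "H\<^sub>g + n * (n * h\<^sub>0 + 1) ^ m \<le> h ^ (c' * m)" .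
      qed simp
      note avoided = C[OF \<open>1 \<le> c' * m\<close> this \<open>x \<noteq> 0\<close>]
      obtain I Y and \<kappa> :: "complex \<Rightarrow> complex \<times> complex \<Rightarrow> int"
        where I: "ideal_of (subring_generated A) I" "x \<notin> I"
        and Y: "finite Y" "card Y \<le> C * (c' * m) ^ d" "\<And>y. y \<in> subring_generated A \<Longrightarrow> \<kappa> y \<in> Y"
          "\<And>y z. y \<in> subring_generated A \<Longrightarrow> z \<in> subring_generated A \<Longrightarrow> \<kappa> y = \<kappa> z \<Longrightarrow> y - z \<in> I"
        by (rule avoided_by_ideal_of_index_leE[OF avoided], rule that) assumption+
      interpret matrix_rep_mod_ideal G n \<rho> "subring_generated A" I
        by unfold_locales (use I(1) entries in auto)
      have "trace_mat (\<rho> g) - trace_mat (\<rho> y) \<notin> I" using I(2) x_y by simp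
      then have "CD G g y \<le> enat (card Y ^ (n * n))"
        by (intro CD_le_index_power[where \<kappa> = \<kappa> and Y = Y] Y(1,3,4) g y(1))
      also have "card Y ^ (n * n) \<le> (C * (c' * m) ^ d) ^ (n * n)" using Y(2) by (rule power_mono) simp
      also have "\<dots> = B * m ^ (d * (n * n))"
        by (simp add: B_def power_mult_distrib power_mult[symmetric])
      finally show ?thesis by simp
    qed
    have "Conj G g X m \<le> enat (B + 1) * enat (((B + 1) * m) ^ (d * (n * n) + 1))" if m: "m \<ge> 1" for m
    proof -
      let ?V = "{CD G g y | y. y \<in> carrier G \<and> conj_class G y \<in> class_ball G X m \<and> conj_class G y \<noteq> conj_class G g}"
      \<comment> \<open>finiteness comes from the bound itself: there are only finitely many extended natural
        numbers below a finite one\<close>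
      have le: "v \<le> enat (B * m ^ (d * (n * n)))" if "v \<in> ?V" for v using that CD[OF m] by blast
      have "finite ?V" using le by (rule finite_enat_bounded)
      moreover have "?V \<noteq> {}" using unit_ball_not_one_class[OF assms(2) X g m] by blast
      ultimately have "Conj G g X m \<le> enat (B * m ^ (d * (n * n)))"
        unfolding Conj_def using le by (intro Max.boundedI) auto
      also have "B * m ^ (d * (n * n)) \<le> (B + 1) * ((B + 1) * m) ^ (d * (n * n) + 1)"
      proof (intro mult_mono)
        have "m ^ (d * (n * n)) \<le> m ^ (d * (n * n) + 1)" using m by (intro power_increasing) auto
        also have "\<dots> \<le> ((B + 1) * m) ^ (d * (n * n) + 1)" by (intro power_mono) auto
        finally show "m ^ (d * (n * n)) \<le> ((B + 1) * m) ^ (d * (n * n) + 1)" .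
      qed auto
      finally show ?thesis by simp
    qed
    then show ?thesis unfolding preceq_def by (intro exI[of _ "B + 1"]) auto
  qed
  then show "\<exists>d::nat. d \<ge> 1 \<and> (\<forall>X. finite_generating_set G X \<longrightarrow> Conj G g X \<preceq> (\<lambda>n. enat (n ^ d)))"
    by (intro exI[of _ "d * (n * n) + 1"]) auto
qed

end
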